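(* Let $H$ be a Hilbert space with inner product $\langle\cdot,\cdot\rangle$ and consider the bilinear system $$\dot z(t)=Az(t)+v(t)Bz(t),\qquad z(0)=z_0\in H,$$ with scalar control $v(t)$. Suppose that (i) $A$ generates a $C_0$-semigroup of contractions $S(t)$ on $H$; (ii) $B$ is a bounded linear operator on $H$; (iii) there exist $\delta,T>0$ such that $$\int_0^T|\langle BS(t)y,S(t)y\rangle|\,dt\ge\delta\|y\|^2,\qquad\forall y\in H.$$ Then for every $r\in(-\infty,2)$ the feedback $$v_r(t)=-\frac{\langle z(t),Bz(t)\rangle}{\|z(t)\|^r}\ \text{ if } z(t)\ne0,\qquad v_r(t)=0\ \text{ if } z(t)=0,$$ strongly stabilizes the system, with the decay estimate $$\|z(t)\|=O\big(t^{-\frac{1}{2-r}}\big)\quad\text{as } t\to+\infty.$$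
   Context: A semigroup of contractions satisfies $\|S(t)\|\le1$ for all $t\ge0$. A feedback $v(t)=V(z(t))$ strongly stabilizes the system if, for the closed-loop system $\dot z=Az+V(z)Bz$: for every $z_0\in H$ there is a unique mild solution $z$ on $[0,+\infty)$ (i.e. continuous with $z(t)=S(t)z_0+\int_0^tS(t-s)V(z(s))Bz(s)\,ds$), $0$ is Lyapunov stable (for every $\varepsilon>0$ there is $\alpha>0$ such that every trajectory starting in the $\alpha$-ball remains in the $\varepsilon$-ball for all $t\ge0$), and $z(t)\to0$ in norm as $t\to+\infty$ for every $z_0$. *)

theory Defs
  imports "HOL-Analysis.Analysis" "HOL-Library.Landau_Symbols"
begin

section \<open>Real and complex Hilbert spaces\<close>

text \<open>
  The library only has real inner product spaces. To cover real and complex Hilbert spaces at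
  once, scalars range over a real normed field with a conjugation. The last axiom determines
  the conjugation, and up to isomorphism the only such fields are the reals and the complex
  numbers.
\<close>

class conj_field = real_normed_field +
  fixes conj :: "'a \<Rightarrow> 'a"
  assumes conj_add: "conj (a + b) = conj a + conj b"
    and conj_mult: "conj (a * b) = conj a * conj b"
    and conj_scaleR_one: "conj (c *\<^sub>R 1) = c *\<^sub>R 1"
    and mult_conj: "a * conj a = ((norm a)\<^sup>2) *\<^sub>R 1"

instantiation real :: conj_field
begin
definition conj_real :: "real \<Rightarrow> real" where "conj_real a = a"
instance by standard (simp_all add: conj_real_def power2_eq_square)
end

instantiation complex :: conj_field
begin
definition conj_complex :: "complex \<Rightarrow> complex" where "conj_complex a = cnj a"
instance
proof
  fix a :: complex
  show "a * conj a = ((norm a)\<^sup>2) *\<^sub>R 1"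
    by (simp add: conj_complex_def complex_norm_square [symmetric] scaleR_conv_of_real)
qed (simp_all add: conj_complex_def scaleR_conv_of_real)
end

text \<open>
  The inner product is linear in its first argument. Its norm is that of the type: by
  polarization, the type-class inner product is the real part of \<open>ip\<close>, so
  requiring \<open>real_inner\<close> of the carrier is no restriction.
\<close>

locale hilbert_space = vector_space scal
  for scal :: "'k::conj_field \<Rightarrow> 'h::{real_inner, complete_space} \<Rightarrow> 'h" +
  fixes ip :: "'h \<Rightarrow> 'h \<Rightarrow> 'k"
  assumes scale_of_real: "scal (of_real c) x = c *\<^sub>R x"
    and ip_add_left: "ip (x + y) w = ip x w + ip y w"
    and ip_scale_left: "ip (scal a x) y = a * ip x y"
    and ip_commute: "ip y x = conj (ip x y)"
    and ip_self: "ip x x = of_real ((norm x)\<^sup>2)"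

lemma (in hilbert_space) inner_is_real_part: "of_real (2 * inner x y) = ip x y + ip y x"
proof -
  have r: "ip z (x + y) = ip z x + ip z y" for z
    by (metis ip_add_left ip_commute conj_add)
  have "of_real ((norm (x + y))\<^sup>2) = ip x x + ip y y + (ip x y + ip y x)"
    by (simp only: ip_self [symmetric] ip_add_left r) (simp add: algebra_simps)
  then have "ip x y + ip y x = of_real ((norm (x + y))\<^sup>2 - (norm x)\<^sup>2 - (norm y)\<^sup>2)"
    by (simp add: ip_self algebra_simps)
  also have "(norm (x + y))\<^sup>2 - (norm x)\<^sup>2 - (norm y)\<^sup>2 = 2 * inner x y"
    by (simp add: power2_norm_eq_inner inner_add_left inner_add_right inner_commute)
  finally show ?thesis by simp
qed

lemma hilbert_space_real:
  "hilbert_space (scaleR :: real \<Rightarrow> 'h \<Rightarrow> 'h::{real_inner, complete_space}) inner"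
  by unfold_locales
    (simp_all add: algebra_simps inner_add_left conj_real_def inner_commute power2_norm_eq_inner)

lemma hilbert_space_complex: "hilbert_space ((*) :: complex \<Rightarrow> _) (\<lambda>x y. x * cnj y)"
  by unfold_locales
    (simp_all add: algebra_simps conj_complex_def scaleR_conv_of_real complex_norm_square [symmetric])

definition bounded_operator ::
    "('k \<Rightarrow> 'h \<Rightarrow> 'h) \<Rightarrow> ('h::real_normed_vector \<Rightarrow> 'h) \<Rightarrow> bool" where
  "bounded_operator scal L \<longleftrightarrow>
     bounded_linear L \<and> (\<forall>a x. L (scal a x) = scal a (L x))"

section \<open>Semigroups and their generators\<close>

definition C0_semigroup ::
    "('k \<Rightarrow> 'h \<Rightarrow> 'h) \<Rightarrow> (real \<Rightarrow> 'h::real_normed_vector \<Rightarrow> 'h) \<Rightarrow> bool" where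
  "C0_semigroup scal S \<longleftrightarrow>
     (\<forall>t\<ge>0. bounded_operator scal (S t)) \<and>
     (\<forall>x. S 0 x = x) \<and>
     (\<forall>s\<ge>0. \<forall>t\<ge>0. \<forall>x. S (s + t) x = S s (S t x)) \<and>
     (\<forall>x. ((\<lambda>t. S t x) \<longlongrightarrow> x) (at_right 0))"

definition contraction_C0_semigroup ::
    "('k \<Rightarrow> 'h \<Rightarrow> 'h) \<Rightarrow> (real \<Rightarrow> 'h::real_normed_vector \<Rightarrow> 'h) \<Rightarrow> bool" where
  "contraction_C0_semigroup scal S \<longleftrightarrow>
     C0_semigroup scal S \<and> (\<forall>t\<ge>0. onorm (S t) \<le> 1)"

text \<open>
  An unbounded operator is given by its domain \<open>D\<close> and a function \<open>A\<close>, whose values outside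
  \<open>D\<close> are irrelevant.
\<close>

definition generates ::
    "'h set \<Rightarrow> ('h \<Rightarrow> 'h) \<Rightarrow> (real \<Rightarrow> 'h::real_normed_vector \<Rightarrow> 'h) \<Rightarrow> bool" where
  "generates D A S \<longleftrightarrow>
     D = {x. \<exists>y. ((\<lambda>h. (S h x - x) /\<^sub>R h) \<longlongrightarrow> y) (at_right 0)} \<and>
     (\<forall>x\<in>D. ((\<lambda>h. (S h x - x) /\<^sub>R h) \<longlongrightarrow> A x) (at_right 0))"

section \<open>Feedback stabilization of the bilinear system\<close>

text \<open>
  Trajectories live on \<open>[0,\<infinity>)\<close>; values of \<open>z\<close> at negative times are irrelevant.
\<close>

definition mild_solution ::
    "('k \<Rightarrow> 'h \<Rightarrow> 'h) \<Rightarrow> (real \<Rightarrow> 'h \<Rightarrow> 'h) \<Rightarrow> ('h \<Rightarrow> 'h) \<Rightarrow> ('h \<Rightarrow> 'k) \<Rightarrow>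
      'h \<Rightarrow> (real \<Rightarrow> 'h::real_normed_vector) \<Rightarrow> bool" where
  "mild_solution scal S B V z0 z \<longleftrightarrow>
     continuous_on {0..} z \<and>
     (\<forall>t\<ge>0. \<exists>I. ((\<lambda>s. S (t - s) (scal (V (z s)) (B (z s)))) has_integral I) {0..t} \<and>
       z t = S t z0 + I)"

definition strongly_stabilizes ::
    "('k \<Rightarrow> 'h \<Rightarrow> 'h) \<Rightarrow> (real \<Rightarrow> 'h \<Rightarrow> 'h) \<Rightarrow> ('h \<Rightarrow> 'h) \<Rightarrow>
      ('h::real_normed_vector \<Rightarrow> 'k) \<Rightarrow> bool" where
  "strongly_stabilizes scal S B V \<longleftrightarrow>
     (\<forall>z0. \<exists>z. mild_solution scal S B V z0 z \<and>
        (\<forall>w. mild_solution scal S B V z0 w \<longrightarrow> (\<forall>t\<ge>0. w t = z t))) \<and>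
     (\<forall>\<epsilon>>0. \<exists>\<alpha>>0. \<forall>z0 z. mild_solution scal S B V z0 z \<longrightarrow> norm z0 < \<alpha> \<longrightarrow>
        (\<forall>t\<ge>0. norm (z t) < \<epsilon>)) \<and>
     (\<forall>z0 z. mild_solution scal S B V z0 z \<longrightarrow> (z \<longlongrightarrow> 0) at_top)"

text \<open>
  Over the complex numbers, the order of the arguments of \<open>ip\<close> matters: by linearity in the
  first argument, \<open>ip (scal (- ip z (B z)) (B z)) z\<close> is real and nonpositive.
\<close>

definition feedback ::
    "('h \<Rightarrow> 'h \<Rightarrow> 'k) \<Rightarrow> ('h \<Rightarrow> 'h) \<Rightarrow> real \<Rightarrow> 'h::real_normed_vector \<Rightarrow> 'k::real_normed_field" where
  "feedback ip B r z = (if z = 0 then 0 else - (ip z (B z) / of_real (norm z powr r)))"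

end

theory Submission
  imports Defs
begin

text \<open>
  With the feedback inserted, the equation is \<open>z' = A z + F z\<close> with the field
  \<open>F z = - (ip z (B z) / norm z powr r) B z\<close>. It is homogeneous of degree \<open>3 - r > 1\<close> and hence
  Lipschitz on balls (\<open>feedback_field_lipschitz\<close>). It is dissipative: with \<open>p z = norm (ip z (B z))\<close>,
  the real part of the inner product of \<open>z\<close> and \<open>F z\<close> is \<open>- p z ^ 2 / norm z powr r\<close>. As \<open>S\<close> is a
  contraction semigroup, mild solutions satisfy an energy inequality (\<open>energy_inequality\<close>), so norms
  do not increase along trajectories. This is Lyapunov stability, and it excludes blow-up: existence
  and uniqueness reduce to a globally Lipschitz field, for which a fixed point argument in a weighted
  sup norm works on the whole half-line.

  Decay comes from comparing, over a window of length \<open>T\<close>, the trajectory starting from \<open>y = z a\<close>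
  with the uncontrolled trajectory \<open>S t y\<close>. The difference is controlled by the integral of \<open>norm (F z)\<close>,
  hence by the integral \<open>P\<close> of \<open>p\<close> along the trajectory. The observability hypothesis on \<open>S t y\<close>
  therefore yields a lower bound for \<open>P\<close> of order \<open>norm y ^ 2\<close>. Since \<open>p ^ 2 / norm z powr r\<close> is
  the dissipation rate, the squared norm loses at least a multiple of \<open>norm y powr (4 - r)\<close> in each
  window (\<open>window_contraction\<close>). These estimates need the norm to remain comparable with its initial
  value during the window; if it does not, it has been halved, and the loss is large anyway. The
  recursion \<open>n' ^ 2 \<le> n ^ 2 (1 - \<kappa> n powr (2 - r))\<close> for the norms at multiples of \<open>T\<close> makes
  \<open>n powr - (2 - r)\<close> grow linearly (\<open>powr_growth_of_recursive_decay\<close>), which is the stated rate.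

  The dynamics is carried out for an abstract field \<open>F\<close> and observation \<open>p\<close> on a real Hilbert space.
  Scalars and the inner product \<open>ip\<close> enter only in verifying the properties of the feedback field.
\<close>

section \<open>Real analysis\<close>

text \<open>
  The squared norm of a mild solution need not be differentiable, since the solution may stay outside
  the domain of the generator. One-sided estimates of its growth are available, and by this lemma
  they suffice for comparison.
\<close>

lemma nonincreasing_if_upper_right_derivative_nonpos:
  fixes f :: "real \<Rightarrow> real"
  assumes "a \<le> b" and cont: "continuous_on {a..b} f"
    and der: "\<And>t e. a \<le> t \<Longrightarrow> t < b \<Longrightarrow> e > 0 \<Longrightarrow>
      eventually (\<lambda>s. f s \<le> f t + e * (s - t)) (at_right t)"
  shows "f b \<le> f a"
proof (rule field_le_epsilon)
  fix \<eta> :: real assume \<eta>: "\<eta> > 0"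
  define e where "e = \<eta> / (b - a + 1)"
  have e: "e > 0" "e * (b - a) \<le> \<eta>"
    using \<eta> \<open>a \<le> b\<close> by (auto simp: e_def field_simps)
  define X where "X = {t \<in> {a..b}. f t \<le> f a + e * (t - a)}"
  have "closed X"
    unfolding X_def by (intro continuous_on_closed_Collect_le continuous_intros cont)
  moreover have "bounded X"
    by (rule bounded_subset[OF bounded_closed_interval[of a b]]) (auto simp: X_def)
  ultimately have "compact X" by (simp add: compact_eq_bounded_closed)
  moreover have "a \<in> X" using \<open>a \<le> b\<close> by (simp add: X_def)
  \<comment> \<open>The last time at which f lies below the line of slope e through its initial value. Before
    the right end point, the bound on the right derivative would keep f below that line a
    little longer.\<close>
  ultimately obtain c where c: "c \<in> X" "\<And>t. t \<in> X \<Longrightarrow> t \<le> c"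
    using compact_attains_sup[of X] by blast
  have "c = b"
  proof (rule ccontr)
    assume "c \<noteq> b"
    then have "c < b" "a \<le> c" using c(1) by (auto simp: X_def)
    have "eventually (\<lambda>s. s \<in> {c<..<b}) (at_right c)"
      using \<open>c < b\<close> by (rule eventually_at_right_real)
    with der[OF \<open>a \<le> c\<close> \<open>c < b\<close> e(1)]
    have "eventually (\<lambda>s. f s \<le> f c + e * (s - c) \<and> s \<in> {c<..<b}) (at_right c)"
      by (rule eventually_conj)
    then obtain s where s: "f s \<le> f c + e * (s - c)" "c < s" "s < b"
      using eventually_happens[of _ "at_right c"] by auto
    moreover have "f c \<le> f a + e * (c - a)" using c(1) by (simp add: X_def)
    ultimately have "s \<in> X"
      using \<open>a \<le> c\<close> by (auto simp: X_def algebra_simps)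
    with c(2) s(2) show False by force
  qed
  with c(1) e(2) show "f b \<le> f a + \<eta>" by (auto simp: X_def)
qed

text \<open>
  The factor \<open>norm z powr - r\<close> of the feedback need not be Lipschitz near zero. The cubic term that it
  multiplies compensates: by the mean value theorem the increment is of degree \<open>- r - 1\<close>, and adding
  \<open>3\<close> leaves the positive degree \<open>2 - r\<close>.
\<close>

lemma powr_minus_diff_bound:
  fixes r w z :: real
  assumes "r < 2" "0 < w" "w \<le> z"
  shows "\<bar>z powr - r - w powr - r\<bar> * w ^ 3 \<le> \<bar>r\<bar> * z powr (2 - r) * (z - w)"
proof (cases "w = z")
  case False
  then have "w < z" using assms by simp
  then have "\<exists>\<xi>. w < \<xi> \<and> \<xi> < z \<and>
      z powr - r - w powr - r = (z - w) * (- r * \<xi> powr (- r - 1))"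
    using \<open>0 < w\<close> by (intro MVT2) (auto intro!: derivative_eq_intros simp: powr_diff)
  then obtain \<xi> where \<xi>: "w < \<xi>" "\<xi> < z"
    and eq: "z powr - r - w powr - r = (z - w) * (- r * \<xi> powr (- r - 1))"
    by blast
  have "\<xi> powr (- r - 1) * w ^ 3 \<le> \<xi> powr (- r - 1) * \<xi> ^ 3"
    using \<xi> assms by (intro mult_left_mono power_mono) auto
  also have "\<dots> = \<xi> powr (2 - r)"
    using \<xi> assms by (simp flip: powr_numeral powr_add)
  also have "\<dots> \<le> z powr (2 - r)"
    using \<xi> assms by (intro powr_mono2) auto
  finally have "\<bar>r\<bar> * (z - w) * (\<xi> powr (- r - 1) * w ^ 3) \<le> \<bar>r\<bar> * (z - w) * z powr (2 - r)"
    using \<open>w < z\<close> by (intro mult_left_mono) auto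
  then show ?thesis
    using \<open>w < z\<close> by (simp add: eq abs_mult mult_ac)
qed simp

text \<open>
  Discrete form of the differential inequality \<open>(n\<^sup>2)' \<le> - \<kappa> n\<^sup>2 n\<^sup>\<gamma>\<close>, which integrates to linear
  growth of \<open>n powr - \<gamma>\<close>. Taking logarithms and using \<open>ln (1 - x) \<le> - x\<close> and \<open>exp y \<ge> 1 + y\<close>
  shows that each step adds at least \<open>\<gamma> \<kappa> / 2\<close>.
\<close>

lemma powr_growth_of_recursive_decay:
  fixes n :: "nat \<Rightarrow> real"
  assumes "\<kappa> > 0" "\<gamma> > 0" and pos: "\<And>k. n k > 0"
    and rec: "\<And>k. (n (Suc k))\<^sup>2 \<le> (n k)\<^sup>2 * (1 - \<kappa> * n k powr \<gamma>)"
  shows "n k powr - \<gamma> \<ge> \<gamma> * \<kappa> / 2 * k"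
proof (induction k)
  case (Suc k)
  define a b x where "a = n (Suc k)" and "b = n k" and "x = \<kappa> * b powr \<gamma>"
  have ab: "a > 0" "b > 0" using pos by (auto simp: a_def b_def)
  have sq: "a\<^sup>2 \<le> b\<^sup>2 * (1 - x)" using rec[of k] by (simp add: a_def b_def x_def)
  have "0 < b\<^sup>2 * (1 - x)" using sq ab by (smt (verit) zero_less_power)
  then have x: "x < 1" using ab by (simp add: zero_less_mult_iff)
  have "2 * ln a = ln (a\<^sup>2)" using ab by (simp add: ln_realpow)
  also have "\<dots> \<le> ln (b\<^sup>2 * (1 - x))" using sq ab by (intro ln_mono) auto
  also have "\<dots> = 2 * ln b + ln (1 - x)" using ab x by (simp add: ln_mult ln_realpow)
  also have "ln (1 - x) \<le> - x" using ln_add_one_self_le_self2[of "- x"] x by simp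
  finally have "2 * ln a \<le> 2 * ln b - x" by simp
  then have "\<gamma> * (2 * ln a) \<le> \<gamma> * (2 * ln b - x)"
    using \<open>\<gamma> > 0\<close> by (intro mult_left_mono) auto
  then have "- \<gamma> * ln b + \<gamma> * x / 2 \<le> - \<gamma> * ln a" by (simp add: algebra_simps)
  then have "exp (- \<gamma> * ln b) * exp (\<gamma> * x / 2) \<le> exp (- \<gamma> * ln a)"
    by (simp only: exp_le_cancel_iff flip: exp_add)
  then have "b powr - \<gamma> * exp (\<gamma> * x / 2) \<le> a powr - \<gamma>"
    using ab by (simp add: powr_def)
  moreover have "b powr - \<gamma> * (1 + \<gamma> * x / 2) \<le> b powr - \<gamma> * exp (\<gamma> * x / 2)"
    by (intro mult_left_mono) auto
  moreover have "b powr - \<gamma> * (1 + \<gamma> * x / 2) = b powr - \<gamma> + \<gamma> * \<kappa> / 2"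
  proof -
    have "b powr - \<gamma> * b powr \<gamma> = 1" using ab by (simp flip: powr_add)
    then show ?thesis by (simp add: x_def algebra_simps)
  qed
  ultimately have "b powr - \<gamma> + \<gamma> * \<kappa> / 2 \<le> a powr - \<gamma>" by linarith
  moreover have "\<gamma> * \<kappa> / 2 * Suc k = \<gamma> * \<kappa> / 2 * k + \<gamma> * \<kappa> / 2" by (simp add: algebra_simps)
  ultimately show ?case using Suc by (simp add: a_def b_def)
qed simp

definition radial_retraction :: "real \<Rightarrow> 'a::real_normed_vector \<Rightarrow> 'a" where
  "radial_retraction R x = (R / max R (norm x)) *\<^sub>R x"

lemma norm_radial_retraction_le:
  assumes "R > 0"
  shows "norm (radial_retraction R x) \<le> R"
proof -
  have "R * norm x \<le> R * max R (norm x)" using assms by (intro mult_left_mono) auto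
  moreover have "max R (norm x) > 0" using assms by auto
  ultimately show ?thesis using assms by (simp add: radial_retraction_def pos_divide_le_eq)
qed

lemma radial_retraction_eq: "R > 0 \<Longrightarrow> norm x \<le> R \<Longrightarrow> radial_retraction R x = x"
  by (simp add: radial_retraction_def max_def)

lemma radial_retraction_lipschitz:
  assumes "R > 0"
  shows "norm (radial_retraction R x - radial_retraction R y) \<le> 2 * norm (x - y)"
proof -
  define m n where "m = max R (norm x)" and "n = max R (norm y)"
  have mn: "m > 0" "n > 0" "R \<le> m" "norm y \<le> n" using assms by (auto simp: m_def n_def)
  have "radial_retraction R x - radial_retraction R y = (R / m) *\<^sub>R (x - y) + (R / m - R / n) *\<^sub>R y"
    by (simp add: radial_retraction_def m_def n_def algebra_simps)
  then have "norm (radial_retraction R x - radial_retraction R y) \<le>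
      (R / m) * norm (x - y) + \<bar>R / m - R / n\<bar> * norm y"
    using norm_triangle_ineq[of "(R / m) *\<^sub>R (x - y)" "(R / m - R / n) *\<^sub>R y"] assms mn by simp
  moreover have "(R / m) * norm (x - y) \<le> 1 * norm (x - y)"
    using mn by (intro mult_right_mono) auto
  moreover have "\<bar>R / m - R / n\<bar> * norm y \<le> norm (x - y)"
  proof -
    have "R / m - R / n = (R / m) * ((n - m) / n)" using mn by (simp add: field_simps)
    then have "\<bar>R / m - R / n\<bar> * norm y = (R / m) * (norm y / n) * \<bar>n - m\<bar>"
      using mn assms by (simp add: abs_mult)
    also have "\<dots> \<le> 1 * \<bar>n - m\<bar>"
      using mn assms by (intro mult_right_mono mult_le_one) auto
    also have "\<dots> \<le> norm (x - y)"
      using norm_triangle_ineq3[of x y] by (auto simp: m_def n_def)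
    finally show ?thesis .
  qed
  ultimately show ?thesis by linarith
qed

section \<open>Contraction semigroups and the Duhamel integral\<close>

text \<open>
  This is the real-linear part of the notion of a contraction semigroup. The dynamics uses scalars
  only through real multiples, so real and complex spaces are treated together.
\<close>

locale contraction_semigroup =
  fixes S :: "real \<Rightarrow> 'a::banach \<Rightarrow> 'a"
  assumes bounded_linear: "t \<ge> 0 \<Longrightarrow> bounded_linear (S t)"
    and at_zero [simp]: "S 0 x = x"
    and add: "s \<ge> 0 \<Longrightarrow> t \<ge> 0 \<Longrightarrow> S (s + t) x = S s (S t x)"
    and norm_le: "t \<ge> 0 \<Longrightarrow> norm (S t x) \<le> norm x"
    and tendsto_at_zero: "((\<lambda>t. S t x) \<longlongrightarrow> x) (at_right 0)"
begin

lemma diff: "t \<ge> 0 \<Longrightarrow> S t (x - y) = S t x - S t y"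
  by (rule linear_diff[OF bounded_linear.linear[OF bounded_linear]])

text \<open>
  Factoring out the semigroup up to the earlier of the two times reduces continuity at every time to
  continuity at time zero.
\<close>

lemma norm_diff_le:
  assumes "s \<ge> 0" "t \<ge> 0"
  shows "norm (S s x - S t x) \<le> norm (S \<bar>s - t\<bar> x - x)"
proof -
  have *: "norm (S b x - S a x) \<le> norm (S (b - a) x - x)" if "0 \<le> a" "a \<le> b" for a b
  proof -
    have "S b x - S a x = S a (S (b - a) x - x)"
      using that add[of a "b - a" x] by (simp add: diff)
    then show ?thesis using that norm_le by simp
  qed
  show ?thesis
    using *[of s t] *[of t s] assms by (cases "s \<le> t") (auto simp: norm_minus_commute)
qed

lemma continuous_on_orbit: "continuous_on {0..} (\<lambda>t. S t x)"
proof (rule continuous_onI)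
  fix t e :: real assume t: "t \<in> {0..}" and "e > 0"
  from tendsto_at_zero[of x] \<open>e > 0\<close>
  have "eventually (\<lambda>h. dist (S h x) x < e) (at_right 0)" by (rule tendstoD)
  then obtain d where d: "d > 0" "\<And>h. 0 < h \<Longrightarrow> h < d \<Longrightarrow> dist (S h x) x < e"
    by (auto simp: eventually_at_right_field)
  have "dist (S s x) (S t x) \<le> e" if "s \<in> {0..}" "dist s t < d" for s
  proof -
    have "dist (S \<bar>s - t\<bar> x) x < e"
      using d(2)[of "\<bar>s - t\<bar>"] that(2) \<open>e > 0\<close> by (cases "s = t") (auto simp: dist_real_def)
    with norm_diff_le[of s t x] that t show ?thesis by (auto simp: dist_norm)
  qed
  with d(1) show "\<exists>d>0. \<forall>s\<in>{0..}. dist s t < d \<longrightarrow> dist (S s x) (S t x) \<le> e" by blast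
qed

text \<open>
  Strong continuity together with the bound \<open>1\<close> on the norms gives joint continuity in time and
  vector.
\<close>

lemma continuous_on_semigroup [continuous_intros]:
  assumes f: "continuous_on X f" and g: "continuous_on X g" and nonneg: "\<And>p. p \<in> X \<Longrightarrow> f p \<ge> 0"
  shows "continuous_on X (\<lambda>p. S (f p) (g p))"
  unfolding continuous_on_def
proof
  fix p assume p: "p \<in> X"
  have "continuous_on X (\<lambda>q. S (f q) (g p))"
    by (rule continuous_on_compose2[OF continuous_on_orbit f]) (use nonneg in auto)
  then have "((\<lambda>q. norm (g q - g p) + norm (S (f q) (g p) - S (f p) (g p))) \<longlongrightarrow> 0) (at p within X)"
    using g p unfolding continuous_on_def by (auto intro!: tendsto_eq_intros tendsto_norm_zero simp: LIM_zero_iff)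
  moreover have "norm (S (f q) (g q) - S (f p) (g p)) \<le>
      norm (g q - g p) + norm (S (f q) (g p) - S (f p) (g p))" if "q \<in> X" for q
  proof -
    have "S (f q) (g q) - S (f p) (g p) = S (f q) (g q - g p) + (S (f q) (g p) - S (f p) (g p))"
      using nonneg \<open>q \<in> X\<close> by (simp add: diff)
    then show ?thesis
      by (metis (no_types, lifting) add_right_mono norm_le norm_triangle_le nonneg \<open>q \<in> X\<close>)
  qed
  then have "eventually (\<lambda>q. norm (S (f q) (g q) - S (f p) (g p)) \<le>
      norm (g q - g p) + norm (S (f q) (g p) - S (f p) (g p))) (at p within X)"
    unfolding eventually_at_filter by (auto intro: always_eventually)
  ultimately have "((\<lambda>q. S (f q) (g q) - S (f p) (g p)) \<longlongrightarrow> 0) (at p within X)"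
    by (rule Lim_null_comparison[rotated])
  then show "((\<lambda>q. S (f q) (g q)) \<longlongrightarrow> S (f p) (g p)) (at p within X)"
    by (simp add: LIM_zero_iff)
qed

definition duhamel :: "(real \<Rightarrow> 'a) \<Rightarrow> real \<Rightarrow> real \<Rightarrow> 'a" where
  "duhamel g a b = integral {a..b} (\<lambda>s. S (b - s) (g s))"

lemma integrand_integrable:
  assumes "continuous_on {a..b} g"
  shows "(\<lambda>s. S (b - s) (g s)) integrable_on {a..b}"
  by (intro integrable_continuous_real continuous_intros assms) auto

text \<open>
  After rescaling to a fixed interval, the Duhamel integral is \<open>b - a\<close> times a mean that depends
  continuously on the end point, by continuity of parameter integrals. Continuity of \<open>duhamel g a\<close>
  and its right derivative at \<open>a\<close> are both read off from this form.
\<close>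

lemma duhamel_scaled:
  assumes "h \<ge> 0" and g: "continuous_on {a..a + h} g"
  shows "duhamel g a (a + h) = h *\<^sub>R integral {0..1} (\<lambda>\<sigma>. S (h * (1 - \<sigma>)) (g (a + h * \<sigma>)))"
proof (cases "h = 0")
  case False
  then have h: "h > 0" using assms by simp
  have "((\<lambda>s. S (a + h - s) (g s)) has_integral duhamel g a (a + h)) (cbox a (a + h))"
    unfolding duhamel_def using integrable_integral[OF integrand_integrable[OF g]] by simp
  from has_integral_affinity'[OF this h, of a]
  have "((\<lambda>\<sigma>. S (h * (1 - \<sigma>)) (g (a + h * \<sigma>))) has_integral duhamel g a (a + h) /\<^sub>R h) {0..1}"
    using h by (simp add: algebra_simps)
  then have "integral {0..1} (\<lambda>\<sigma>. S (h * (1 - \<sigma>)) (g (a + h * \<sigma>))) = duhamel g a (a + h) /\<^sub>R h"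
    by (rule integral_unique)
  then show ?thesis using h by simp
qed (simp add: duhamel_def)

lemma continuous_on_duhamel_mean:
  assumes "continuous_on {a..} g"
  shows "continuous_on {0..} (\<lambda>h. integral {0..1} (\<lambda>\<sigma>. S (h * (1 - \<sigma>)) (g (a + h * \<sigma>))))"
proof -
  have "continuous_on ({0..} \<times> cbox 0 1) (\<lambda>(h, \<sigma>). S (h * (1 - \<sigma>)) (g (a + h * \<sigma>)))"
    unfolding case_prod_beta
    by (intro continuous_intros continuous_on_compose2[OF assms]) auto
  from integral_continuous_on_param[OF this] show ?thesis by simp
qed

lemma continuous_on_duhamel:
  assumes "continuous_on {a..} g"
  shows "continuous_on {a..} (duhamel g a)"
proof -
  let ?m = "\<lambda>h. integral {0..1} (\<lambda>\<sigma>. S (h * (1 - \<sigma>)) (g (a + h * \<sigma>)))"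
  have "continuous_on {a..} (\<lambda>t. (t - a) *\<^sub>R ?m (t - a))"
    by (intro continuous_intros continuous_on_compose2[OF continuous_on_duhamel_mean[OF assms]]) auto
  moreover have "(t - a) *\<^sub>R ?m (t - a) = duhamel g a t" if "t \<in> {a..}" for t
    using duhamel_scaled[of "t - a" a g] that continuous_on_subset[OF assms] by force
  ultimately show ?thesis by (rule continuous_on_eq)
qed

lemma duhamel_derivative:
  assumes "continuous_on {a..} g"
  shows "((\<lambda>t. duhamel g a t /\<^sub>R (t - a)) \<longlongrightarrow> g a) (at_right a)"
proof -
  let ?m = "\<lambda>h. integral {0..1} (\<lambda>\<sigma>. S (h * (1 - \<sigma>)) (g (a + h * \<sigma>)))"
  have "continuous_on {a..} (\<lambda>t. ?m (t - a))"
    by (intro continuous_intros continuous_on_compose2[OF continuous_on_duhamel_mean[OF assms]]) auto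
  then have "((\<lambda>t. ?m (t - a)) \<longlongrightarrow> ?m (a - a)) (at a within {a..})"
    unfolding continuous_on_def by blast
  then have "((\<lambda>t. ?m (t - a)) \<longlongrightarrow> ?m (a - a)) (at_right a)"
    by (rule tendsto_within_subset) auto
  then have "((\<lambda>t. ?m (t - a)) \<longlongrightarrow> g a) (at_right a)" by simp
  moreover have "eventually (\<lambda>t. ?m (t - a) = duhamel g a t /\<^sub>R (t - a)) (at_right a)"
    using eventually_at_right_less[of a]
  proof eventually_elim
    case (elim t)
    then show ?case
      using duhamel_scaled[of "t - a" a g] continuous_on_subset[OF assms] by force
  qed
  ultimately show ?thesis by (rule Lim_transform_eventually)
qed

lemma duhamel_shift:
  assumes "a \<le> b" "b \<le> c" and g: "continuous_on {a..c} g"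
  shows "duhamel g a c = S (c - b) (duhamel g a b) + duhamel g b c"
proof -
  have "duhamel g a c =
      integral {a..b} (\<lambda>s. S (c - s) (g s)) + integral {b..c} (\<lambda>s. S (c - s) (g s))"
    unfolding duhamel_def
    by (rule Henstock_Kurzweil_Integration.integral_combine[symmetric])
      (use assms integrand_integrable in auto)
  also have "integral {a..b} (\<lambda>s. S (c - s) (g s)) = integral {a..b} (S (c - b) \<circ> (\<lambda>s. S (b - s) (g s)))"
  proof (rule Henstock_Kurzweil_Integration.integral_cong)
    fix s assume "s \<in> {a..b}"
    then show "S (c - s) (g s) = (S (c - b) \<circ> (\<lambda>s. S (b - s) (g s))) s"
      using add[of "c - b" "b - s" "g s"] assms by simp
  qed
  also have "\<dots> = S (c - b) (duhamel g a b)"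
    unfolding duhamel_def
    by (rule Henstock_Kurzweil_Integration.integral_linear)
      (use assms in \<open>auto intro!: integrand_integrable bounded_linear continuous_on_subset[OF g]\<close>)
  finally show ?thesis by (simp add: duhamel_def)
qed

lemma norm_duhamel_le:
  assumes g: "continuous_on {a..b} g" and k: "k integrable_on {a..b}"
    and le: "\<And>s. s \<in> {a..b} \<Longrightarrow> norm (g s) \<le> k s"
  shows "norm (duhamel g a b) \<le> integral {a..b} k"
  unfolding duhamel_def
proof (rule Henstock_Kurzweil_Integration.integral_norm_bound_integral[OF integrand_integrable[OF g] k])
  fix s assume "s \<in> {a..b}"
  then show "norm (S (b - s) (g s)) \<le> k s"
    using le norm_le[of "b - s" "g s"] by force
qed

text \<open>
  In the norm with weight \<open>exp (- \<omega> t)\<close> on the half-line, the Duhamel integral is bounded by \<open>1 / \<omega>\<close>.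
  A large \<open>\<omega>\<close> turns Lipschitz estimates into contraction estimates that hold for all times at once.
\<close>

lemma norm_duhamel_exp_le:
  assumes g: "continuous_on {0..} g" and "\<omega> > 0" "t \<ge> 0" "C \<ge> 0"
    and le: "\<And>s. s \<ge> 0 \<Longrightarrow> norm (g s) \<le> C * exp (\<omega> * s)"
  shows "norm (duhamel g 0 t) \<le> C / \<omega> * exp (\<omega> * t)"
proof -
  have "((\<lambda>s. C * exp (\<omega> * s)) has_integral C / \<omega> * exp (\<omega> * t) - C / \<omega> * exp (\<omega> * 0)) {0..t}"
    using \<open>\<omega> > 0\<close> \<open>t \<ge> 0\<close>
    by (intro fundamental_theorem_of_calculus)
      (auto intro!: derivative_eq_intros simp flip: has_real_derivative_iff_has_vector_derivative)
  then have "(\<lambda>s. C * exp (\<omega> * s)) integrable_on {0..t}"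
    "integral {0..t} (\<lambda>s. C * exp (\<omega> * s)) = C / \<omega> * exp (\<omega> * t) - C / \<omega>"
    by (auto simp: has_integral_iff)
  moreover have "C / \<omega> \<ge> 0" using \<open>\<omega> > 0\<close> \<open>C \<ge> 0\<close> by simp
  ultimately show ?thesis
    using norm_duhamel_le[of 0 t g "\<lambda>s. C * exp (\<omega> * s)"] continuous_on_subset[OF g] le by force
qed

lemma duhamel_diff:
  assumes "continuous_on {a..b} f" "continuous_on {a..b} g"
  shows "duhamel (\<lambda>s. f s - g s) a b = duhamel f a b - duhamel g a b"
proof -
  have "duhamel (\<lambda>s. f s - g s) a b = integral {a..b} (\<lambda>s. S (b - s) (f s) - S (b - s) (g s))"
    unfolding duhamel_def by (rule Henstock_Kurzweil_Integration.integral_cong) (simp add: diff)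
  then show ?thesis
    unfolding duhamel_def
    by (simp add: Henstock_Kurzweil_Integration.integral_diff integrand_integrable assms)
qed

end

section \<open>Mild solutions\<close>

context contraction_semigroup
begin

text \<open>
  The mild solution of \<open>z' = A z + g\<close>, where \<open>A\<close> generates \<open>S\<close>. The source term is a function of
  time, so the same notion covers nonlinear equations, for which \<open>g\<close> is \<open>\<lambda>t. F (z t)\<close>.
\<close>

definition mild :: "(real \<Rightarrow> 'a) \<Rightarrow> 'a \<Rightarrow> (real \<Rightarrow> 'a) \<Rightarrow> bool" where
  "mild g z0 z \<longleftrightarrow> continuous_on {0..} g \<and> (\<forall>t\<ge>0. z t = S t z0 + duhamel g 0 t)"

lemma mild_initial_value: "mild g z0 z \<Longrightarrow> z 0 = z0"
  by (simp add: mild_def duhamel_def)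

lemma continuous_on_mild:
  assumes "mild g z0 z"
  shows "continuous_on {0..} z"
proof -
  have "continuous_on {0..} (\<lambda>t. S t z0 + duhamel g 0 t)"
    using assms by (intro continuous_intros continuous_on_duhamel) (auto simp: mild_def)
  then show ?thesis
    by (rule continuous_on_eq) (use assms in \<open>auto simp: mild_def\<close>)
qed

lemma mild_cong:
  assumes "mild f z0 z" and eq: "\<And>t. t \<ge> 0 \<Longrightarrow> f t = g t"
  shows "mild g z0 z"
proof -
  have "continuous_on {0..} g"
    using assms by (auto simp: mild_def intro: continuous_on_eq)
  moreover have "duhamel f 0 t = duhamel g 0 t" for t
    unfolding duhamel_def by (rule Henstock_Kurzweil_Integration.integral_cong) (simp add: eq)
  ultimately show ?thesis using assms(1) by (simp add: mild_def)
qed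

lemma mild_restart:
  assumes "mild g z0 z" "0 \<le> a" "a \<le> b"
  shows "z b = S (b - a) (z a) + duhamel g a b"
proof -
  have "continuous_on {0..b} g" using assms by (auto simp: mild_def intro: continuous_on_subset)
  then have "duhamel g 0 b = S (b - a) (duhamel g 0 a) + duhamel g a b"
    using assms by (intro duhamel_shift) auto
  moreover have "S b z0 = S (b - a) (S a z0)" using add[of "b - a" a z0] assms by simp
  moreover have "S (b - a) (x + y) = S (b - a) x + S (b - a) y" for x y
    using assms by (intro linear_add bounded_linear.linear bounded_linear) auto
  ultimately show ?thesis using assms by (simp add: mild_def)
qed

text \<open>
  The substitution \<open>z t = exp (\<omega> t) u t\<close> makes the integral equation a fixed point problem for bounded
  continuous \<open>u\<close>. With \<open>\<omega> = 2 L + 1\<close> the map is a contraction, and a global solution is obtained in one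
  step, without gluing local solutions.
\<close>

lemma lipschitz_mild_solution_exists:
  fixes F :: "'a \<Rightarrow> 'a"
  assumes L: "L \<ge> 0" and lip: "\<And>x y. norm (F x - F y) \<le> L * norm (x - y)"
  shows "\<exists>z. mild (\<lambda>t. F (z t)) z0 z"
proof -
  define \<omega> where "\<omega> = 2 * L + 1"
  have \<omega>: "\<omega> > 0" "L / \<omega> \<le> 1 / 2" using L by (auto simp: \<omega>_def field_simps)
  have contF: "continuous_on UNIV F"
    by (rule lipschitz_on_continuous_on[of L]) (auto intro!: lipschitz_onI simp: dist_norm lip L)
  define G where "G u s = F (exp (\<omega> * s) *\<^sub>R apply_bcontfun u s)" for u :: "real \<Rightarrow>\<^sub>C 'a" and s
  have contG: "continuous_on X (G u)" for X u
    unfolding G_def by (intro continuous_on_compose2[OF contF] continuous_intros) auto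
  define W where "W u t = exp (- \<omega> * t) *\<^sub>R (S t z0 + duhamel (G u) 0 t)" for u t
  have contW: "continuous_on {0..} (W u)" for u
    unfolding W_def by (intro continuous_intros continuous_on_duhamel contG) auto
  have boundG: "norm (G u s) \<le> (norm (F 0) + L * norm u) * exp (\<omega> * s)" if "s \<ge> 0" for u s
  proof -
    have "norm (G u s) \<le> norm (F 0) + norm (G u s - F 0)"
      using norm_triangle_ineq[of "F 0" "G u s - F 0"] by simp
    also have "norm (G u s - F 0) \<le> L * (exp (\<omega> * s) * norm (apply_bcontfun u s))"
      using lip[of "exp (\<omega> * s) *\<^sub>R apply_bcontfun u s" 0] by (simp add: G_def)
    also have "\<dots> \<le> L * (exp (\<omega> * s) * norm u)"
      using L by (intro mult_left_mono norm_bounded) auto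
    also have "norm (F 0) \<le> norm (F 0) * exp (\<omega> * s)"
      using \<omega> \<open>s \<ge> 0\<close> by (intro mult_right_le_one_le[THEN order_trans] mult_le_cancel_left1[THEN iffD2]) auto
    finally show ?thesis by (simp add: algebra_simps)
  qed
  have boundW: "norm (W u t) \<le> norm z0 + (norm (F 0) + L * norm u) / \<omega>" if "t \<ge> 0" for u t
  proof -
    have "norm (S t z0 + duhamel (G u) 0 t) \<le>
        norm z0 * exp (\<omega> * t) + (norm (F 0) + L * norm u) / \<omega> * exp (\<omega> * t)"
    proof (rule norm_triangle_mono)
      have "norm (S t z0) \<le> norm z0 * 1" using norm_le that by simp
      also have "\<dots> \<le> norm z0 * exp (\<omega> * t)"
        using \<omega> that by (intro mult_left_mono) auto
      finally show "norm (S t z0) \<le> norm z0 * exp (\<omega> * t)" .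
      show "norm (duhamel (G u) 0 t) \<le> (norm (F 0) + L * norm u) / \<omega> * exp (\<omega> * t)"
        using L that \<omega> by (intro norm_duhamel_exp_le boundG contG) auto
    qed
    then have "exp (- \<omega> * t) * norm (S t z0 + duhamel (G u) 0 t) \<le>
        exp (- \<omega> * t) * ((norm z0 + (norm (F 0) + L * norm u) / \<omega>) * exp (\<omega> * t))"
      by (intro mult_left_mono) (auto simp: algebra_simps)
    also have "\<dots> = norm z0 + (norm (F 0) + L * norm u) / \<omega>"
      by (simp add: exp_minus)
    finally show ?thesis by (simp add: W_def)
  qed
  \<comment> \<open>The fixed point space consists of functions on the whole line; negative times repeat the
    value at zero.\<close>
  define \<Phi> where "\<Phi> u = Bcontfun (\<lambda>t. W u (max 0 t))" for u
  have \<Phi>: "apply_bcontfun (\<Phi> u) t = W u (max 0 t)" for u t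
  proof -
    have "(\<lambda>t. W u (max 0 t)) \<in> bcontfun"
      by (rule bcontfun_normI[OF _ boundW])
        (intro continuous_on_compose2[OF contW] continuous_intros, auto)
    then show ?thesis by (simp add: \<Phi>_def Bcontfun_inverse)
  qed
  have "dist (\<Phi> u) (\<Phi> v) \<le> 1 / 2 * dist u v" for u v
  proof (rule dist_bound)
    fix t :: real
    define s where "s = max 0 t"
    have "s \<ge> 0" by (simp add: s_def)
    have "norm (duhamel (\<lambda>s. G u s - G v s) 0 s) \<le> (L * dist u v) / \<omega> * exp (\<omega> * s)"
    proof (rule norm_duhamel_exp_le)
      fix s :: real
      have "norm (G u s - G v s) \<le> L * (exp (\<omega> * s) * dist (apply_bcontfun u s) (apply_bcontfun v s))"
        using lip[of "exp (\<omega> * s) *\<^sub>R apply_bcontfun u s" "exp (\<omega> * s) *\<^sub>R apply_bcontfun v s"]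
        by (simp add: G_def dist_norm flip: scaleR_diff_right)
      also have "\<dots> \<le> L * (exp (\<omega> * s) * dist u v)"
        using L by (intro mult_left_mono dist_bounded) auto
      finally show "norm (G u s - G v s) \<le> L * dist u v * exp (\<omega> * s)" by (simp add: mult_ac)
    qed (use L \<omega> \<open>s \<ge> 0\<close> in \<open>auto intro!: continuous_intros contG\<close>)
    then have "exp (- \<omega> * s) * norm (duhamel (\<lambda>s. G u s - G v s) 0 s)
        \<le> exp (- \<omega> * s) * ((L * dist u v) / \<omega> * exp (\<omega> * s))"
      by (intro mult_left_mono) auto
    also have "\<dots> = L / \<omega> * dist u v" by (simp add: exp_minus)
    also have "\<dots> \<le> 1 / 2 * dist u v" using \<omega> by (intro mult_right_mono) auto
    finally show "dist (apply_bcontfun (\<Phi> u) t) (apply_bcontfun (\<Phi> v) t) \<le> 1 / 2 * dist u v"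
      by (simp add: \<Phi> W_def dist_norm duhamel_diff contG flip: s_def scaleR_diff_right)
  qed
  then have "\<exists>!u. \<Phi> u = u" by (intro banach_fix_type[of "1 / 2"]) auto
  then obtain u where u: "\<Phi> u = u" by auto
  define z where "z t = exp (\<omega> * t) *\<^sub>R apply_bcontfun u t" for t
  have "z t = S t z0 + duhamel (G u) 0 t" if "t \<ge> 0" for t
  proof -
    have "apply_bcontfun u t = W u t" using \<Phi>[of u t] that by (simp add: u max_def)
    then show ?thesis by (simp add: z_def W_def exp_minus)
  qed
  moreover have "G u = (\<lambda>t. F (z t))" by (simp add: fun_eq_iff G_def z_def)
  ultimately have "mild (\<lambda>t. F (z t)) z0 z" using contG[of _ u] by (simp add: mild_def)
  then show ?thesis by blast
qed

text \<open>
  Feeding a bound \<open>M exp (\<omega> t)\<close> on the distance of two solutions into the Duhamel formula halves \<open>M\<close>.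
  The iteration replaces a Gronwall inequality.
\<close>

lemma mild_solutions_equal:
  assumes z: "mild f z0 z" and w: "mild g z0 w" and "L \<ge> 0"
    and bound: "\<And>t. t \<ge> 0 \<Longrightarrow> norm (z t - w t) \<le> M"
    and lip: "\<And>t. t \<ge> 0 \<Longrightarrow> norm (f t - g t) \<le> L * norm (z t - w t)"
    and "t \<ge> 0"
  shows "z t = w t"
proof -
  define \<omega> where "\<omega> = 2 * L + 1"
  have \<omega>: "\<omega> > 0" "L / \<omega> \<le> 1 / 2" using \<open>L \<ge> 0\<close> by (auto simp: \<omega>_def field_simps)
  have "M \<ge> 0" using bound[of 0] by (auto intro: order_trans[OF norm_ge_zero])
  have cont: "continuous_on {0..} f" "continuous_on {0..} g" using z w by (auto simp: mild_def)
  have iter: "\<forall>t\<ge>0. norm (z t - w t) \<le> M / 2 ^ n * exp (\<omega> * t)" for n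
  proof (induction n)
    case 0
    have "norm (z t - w t) \<le> M * exp (\<omega> * t)" if "t \<ge> 0" for t
    proof -
      have "M * 1 \<le> M * exp (\<omega> * t)" using \<open>M \<ge> 0\<close> \<omega> that by (intro mult_left_mono) auto
      then show ?thesis using bound[OF that] by simp
    qed
    then show ?case by simp
  next
    case (Suc n)
    show ?case
    proof (intro allI impI)
      fix t :: real assume t: "t \<ge> 0"
      have "norm (duhamel (\<lambda>s. f s - g s) 0 t) \<le> (L * (M / 2 ^ n)) / \<omega> * exp (\<omega> * t)"
      proof (rule norm_duhamel_exp_le)
        fix s :: real assume "s \<ge> 0"
        have "norm (f s - g s) \<le> L * (M / 2 ^ n * exp (\<omega> * s))"
          using lip[OF \<open>s \<ge> 0\<close>] Suc \<open>s \<ge> 0\<close> \<open>L \<ge> 0\<close> by (meson mult_left_mono order_trans)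
        then show "norm (f s - g s) \<le> L * (M / 2 ^ n) * exp (\<omega> * s)" by simp
      qed (use t \<omega> \<open>L \<ge> 0\<close> \<open>M \<ge> 0\<close> cont in \<open>auto intro!: continuous_intros\<close>)
      also have "\<dots> = (L / \<omega>) * (M / 2 ^ n * exp (\<omega> * t))" by (simp add: mult_ac)
      also have "\<dots> \<le> 1 / 2 * (M / 2 ^ n * exp (\<omega> * t))"
        using \<omega> \<open>M \<ge> 0\<close> by (intro mult_right_mono) auto
      also have "duhamel (\<lambda>s. f s - g s) 0 t = z t - w t"
        using z w t cont by (subst duhamel_diff) (auto simp: mild_def intro: continuous_on_subset)
      finally show "norm (z t - w t) \<le> M / 2 ^ Suc n * exp (\<omega> * t)" by simp
    qed
  qed
  have "(\<lambda>n. (M * exp (\<omega> * t)) * (1 / 2) ^ n) \<longlonglongrightarrow> (M * exp (\<omega> * t)) * 0"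
    by (intro tendsto_intros LIMSEQ_realpow_zero) auto
  moreover have "norm (z t - w t) \<le> (M * exp (\<omega> * t)) * (1 / 2) ^ n" for n
    using iter[of n] \<open>t \<ge> 0\<close> by (simp add: power_divide)
  ultimately have "norm (z t - w t) \<le> 0"
    by (intro LIMSEQ_le_const[of _ 0]) auto
  then show ?thesis by simp
qed

end

locale hilbert_contraction_semigroup = contraction_semigroup S
  for S :: "real \<Rightarrow> 'a::{real_inner, banach} \<Rightarrow> 'a"
begin

text \<open>
  For a classical solution this is the integrated form of \<open>(norm z ^ 2)' = 2 inner z (A z + g)\<close> with
  \<open>inner z (A z) \<le> 0\<close>. For a mild solution the contraction property replaces dissipativity of \<open>A\<close>:
  the restarted Duhamel formula bounds the right derivative of the squared norm at each time.
\<close>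

lemma energy_inequality:
  assumes z: "mild g z0 z" and "0 \<le> a" "a \<le> b"
  shows "(norm (z b))\<^sup>2 \<le> (norm (z a))\<^sup>2 + integral {a..b} (\<lambda>s. 2 * inner (z s) (g s))"
proof -
  define k where "k s = 2 * inner (z s) (g s)" for s
  define \<psi> where "\<psi> t = (norm (z t))\<^sup>2 - integral {a..t} k" for t
  have contz: "continuous_on {0..} z" by (rule continuous_on_mild[OF z])
  have contg: "continuous_on {0..} g" using z by (simp add: mild_def)
  have contk: "continuous_on {0..} k" unfolding k_def by (intro continuous_intros contz contg)
  have contk': "continuous_on {c..d} k" if "c \<ge> 0" for c d
    using contk by (rule continuous_on_subset) (use that in auto)
  have "\<psi> b \<le> \<psi> a"
  proof (rule nonincreasing_if_upper_right_derivative_nonpos[OF \<open>a \<le> b\<close>])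
    show "continuous_on {a..b} \<psi>"
      unfolding \<psi>_def
      by (intro continuous_intros continuous_on_subset[OF contz] indefinite_integral_continuous_1
          integrable_continuous_real contk') (use assms in auto)
  next
    fix t e :: real assume t: "a \<le> t" "t < b" and "e > 0"
    have t0: "t \<ge> 0" using t assms by simp
    have "((\<lambda>s. duhamel g t s /\<^sub>R (s - t)) \<longlongrightarrow> g t) (at_right t)"
      by (rule duhamel_derivative[OF continuous_on_subset[OF contg]]) (use t0 in auto)
    moreover have "(z \<longlongrightarrow> z t) (at_right t)"
      using contz t0 unfolding continuous_on_def
      by (meson atLeast_iff greaterThan_iff less_eq_real_def order_trans subsetI tendsto_within_subset)
    moreover have "((\<lambda>s. integral {t..s} k / (s - t)) \<longlongrightarrow> k t) (at_right t)"
    proof -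
      have "((\<lambda>s. integral {t..s} k) has_real_derivative k t) (at t within {t..t + 1})"
        by (intro integral_has_real_derivative contk') (use t0 in auto)
      then show ?thesis by (simp add: has_field_derivative_iff at_within_Icc_at_right)
    qed
    ultimately have "((\<lambda>s. 2 * inner (z s) (duhamel g t s /\<^sub>R (s - t)) - integral {t..s} k / (s - t))
        \<longlongrightarrow> 2 * inner (z t) (g t) - k t) (at_right t)"
      by (intro tendsto_intros)
    then have "eventually (\<lambda>s. 2 * inner (z s) (duhamel g t s /\<^sub>R (s - t)) - integral {t..s} k / (s - t) < e)
        (at_right t)"
      using \<open>e > 0\<close> by (intro order_tendstoD(2)) (auto simp: k_def)
    then show "eventually (\<lambda>s. \<psi> s \<le> \<psi> t + e * (s - t)) (at_right t)"
      using eventually_at_right_less[of t]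
    proof eventually_elim
      case (elim s)
      define J where "J = duhamel g t s"
      \<comment> \<open>Solving the Duhamel formula for S (s - t) (z t), whose norm is at most that of z t, and
        expanding the square leaves - (norm J)^2, of favourable sign.\<close>
      have "S (s - t) (z t) = z s - J"
        using mild_restart[OF z t0, of s] elim by (simp add: J_def)
      then have "(norm (z s - J))\<^sup>2 \<le> (norm (z t))\<^sup>2"
        using norm_le[of "s - t" "z t"] elim by (simp add: power_mono)
      moreover have "(norm (z s - J))\<^sup>2 = (norm (z s))\<^sup>2 - 2 * inner (z s) J + (norm J)\<^sup>2"
        by (simp add: power2_norm_eq_inner inner_diff_left inner_diff_right inner_commute)
      ultimately have 1: "(norm (z s))\<^sup>2 \<le> (norm (z t))\<^sup>2 + 2 * inner (z s) J"
        using zero_le_power2[of "norm J"] by linarith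
      define d where "d = s - t"
      have "d > 0" using elim by (simp add: d_def)
      have "(2 * inner (z s) (J /\<^sub>R d) - integral {t..s} k / d) * d \<le> e * d"
        using elim \<open>d > 0\<close> by (intro mult_right_mono) (auto simp: J_def d_def)
      moreover have "(2 * inner (z s) (J /\<^sub>R d) - integral {t..s} k / d) * d
          = 2 * inner (z s) J - integral {t..s} k"
        using \<open>d > 0\<close> by (simp add: field_simps)
      moreover have "integral {a..t} k + integral {t..s} k = integral {a..s} k"
        using t elim assms
        by (intro Henstock_Kurzweil_Integration.integral_combine integrable_continuous_real contk') auto
      ultimately show ?case using 1 by (simp add: \<psi>_def d_def)
    qed
  qed
  then show ?thesis unfolding \<psi>_def k_def by simp
qed

lemma dissipative_norm_decreasing:
  assumes "mild g z0 z" "\<And>s. s \<ge> 0 \<Longrightarrow> inner (z s) (g s) \<le> 0" "0 \<le> a" "a \<le> b"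
  shows "norm (z b) \<le> norm (z a)"
proof -
  have "continuous_on {a..b} (\<lambda>s. 2 * inner (z s) (g s))"
    using assms continuous_on_mild[OF assms(1)]
    by (intro continuous_intros) (auto simp: mild_def elim!: continuous_on_subset)
  then have "integral {a..b} (\<lambda>s. 2 * inner (z s) (g s)) \<le> integral {a..b} (\<lambda>_. 0)"
    using assms by (intro Henstock_Kurzweil_Integration.integral_le integrable_continuous_real) auto
  then have "integral {a..b} (\<lambda>s. 2 * inner (z s) (g s)) \<le> 0" by simp
  then have "(norm (z b))\<^sup>2 \<le> (norm (z a))\<^sup>2" using energy_inequality[OF assms(1,3,4)] by linarith
  then show ?thesis by (rule power2_le_imp_le) simp
qed

text \<open>
  Composing \<open>F\<close> with the retraction onto a ball makes it globally Lipschitz. The retraction multiplies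
  by a positive number, so the truncated field is still dissipative, its solution does not leave the
  ball, and there truncation changes nothing.
\<close>

lemma dissipative_mild_solution_exists:
  fixes F :: "'a \<Rightarrow> 'a"
  assumes lip: "\<And>R. R > 0 \<Longrightarrow> \<exists>L\<ge>0. \<forall>x y. norm x \<le> R \<longrightarrow> norm y \<le> R \<longrightarrow>
      norm (F x - F y) \<le> L * norm (x - y)"
    and dissip: "\<And>x. inner x (F x) \<le> 0"
  shows "\<exists>z. mild (\<lambda>t. F (z t)) z0 z"
proof -
  define R where "R = norm z0 + 1"
  have R: "R > 0" using norm_ge_zero[of z0] unfolding R_def by linarith
  let ?P = "radial_retraction R"
  obtain L where L: "L \<ge> 0"
    "\<And>x y. norm x \<le> R \<Longrightarrow> norm y \<le> R \<Longrightarrow> norm (F x - F y) \<le> L * norm (x - y)"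
    using lip[OF R] by blast
  have "norm (F (?P x) - F (?P y)) \<le> (L * 2) * norm (x - y)" for x y
  proof -
    have "norm (F (?P x) - F (?P y)) \<le> L * norm (?P x - ?P y)"
      by (intro L norm_radial_retraction_le R)
    also have "\<dots> \<le> L * (2 * norm (x - y))"
      by (intro mult_left_mono radial_retraction_lipschitz R L)
    finally show ?thesis by simp
  qed
  then obtain z where z: "mild (\<lambda>t. F (?P (z t))) z0 z"
    using lipschitz_mild_solution_exists[of "L * 2" "\<lambda>x. F (?P x)" z0] L(1) by auto
  have "inner x (F (?P x)) \<le> 0" for x
  proof -
    define c where "c = R / max R (norm x)"
    have "c > 0" using R by (auto simp: c_def)
    moreover have "c * inner x (F (?P x)) \<le> 0"
      using dissip[of "?P x"] by (simp add: radial_retraction_def flip: c_def)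
    ultimately show ?thesis by (simp add: mult_le_0_iff)
  qed
  then have "norm (z t) \<le> R" if "t \<ge> 0" for t
    using dissipative_norm_decreasing[OF z _ order_refl that] mild_initial_value[OF z] by (simp add: R_def)
  then have "?P (z t) = z t" if "t \<ge> 0" for t
    using radial_retraction_eq[OF R] that by blast
  then have "mild (\<lambda>t. F (z t)) z0 z" by (intro mild_cong[OF z]) simp
  then show ?thesis by blast
qed

text \<open>
  Both solutions stay in the ball of radius \<open>norm z0\<close> by dissipativity, where one Lipschitz constant
  applies to them.
\<close>

lemma dissipative_mild_solution_unique:
  fixes F :: "'a \<Rightarrow> 'a"
  assumes lip: "\<And>R. R > 0 \<Longrightarrow> \<exists>L\<ge>0. \<forall>x y. norm x \<le> R \<longrightarrow> norm y \<le> R \<longrightarrow>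
      norm (F x - F y) \<le> L * norm (x - y)"
    and dissip: "\<And>x. inner x (F x) \<le> 0"
    and z: "mild (\<lambda>t. F (z t)) z0 z" and w: "mild (\<lambda>t. F (w t)) z0 w" and "t \<ge> 0"
  shows "z t = w t"
proof -
  define R where "R = norm z0 + 1"
  have R: "R > 0" using norm_ge_zero[of z0] unfolding R_def by linarith
  obtain L where L: "L \<ge> 0"
    "\<And>x y. norm x \<le> R \<Longrightarrow> norm y \<le> R \<Longrightarrow> norm (F x - F y) \<le> L * norm (x - y)"
    using lip[OF R] by blast
  have bound: "norm (z t) \<le> R" "norm (w t) \<le> R" if "t \<ge> 0" for t
    using dissipative_norm_decreasing[OF z dissip order_refl that] mild_initial_value[OF z]
      dissipative_norm_decreasing[OF w dissip order_refl that] mild_initial_value[OF w]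
    by (simp_all add: R_def)
  show ?thesis
  proof (rule mild_solutions_equal[OF z w L(1)])
    show "norm (z t - w t) \<le> R + R" if "t \<ge> 0" for t
      using norm_triangle_ineq4[of "z t" "w t"] bound[OF that] by linarith
  qed (use bound L \<open>t \<ge> 0\<close> in auto)
qed

end

section \<open>Decay of dissipative flows\<close>

text \<open>
  Along a time window on which the norm loses at most half of its value, every power of the norm may
  be replaced by its initial value, up to a constant and whatever the sign of the exponent.
\<close>

lemma powr_le_on_dyadic_window:
  fixes n x e :: real
  assumes "n > 0" "n / 2 \<le> x" "x \<le> n"
  shows "x powr e \<le> 2 powr \<bar>e\<bar> * n powr e"
proof (cases "e \<ge> 0")
  case True
  then have "x powr e \<le> 1 * n powr e" using assms by (simp add: powr_mono2)
  also have "\<dots> \<le> 2 powr \<bar>e\<bar> * n powr e" by (intro mult_right_mono ge_one_powr_ge_zero) auto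
  finally show ?thesis .
next
  case False
  then have "x powr e \<le> (n / 2) powr e" using assms by (intro powr_mono2') auto
  also have "\<dots> = 2 powr \<bar>e\<bar> * n powr e"
    using False assms by (simp add: powr_divide powr_minus field_simps)
  finally show ?thesis .
qed

text \<open>
  This isolates what the decay estimate needs to know about the closed loop. In the application
  \<open>F z = - (ip z (B z) / norm z powr r) B z\<close> and \<open>p z = norm (ip z (B z))\<close>: the observation \<open>p\<close>
  measures the dissipation rate of \<open>F\<close>, controls the size of \<open>F\<close>, and is observable along the
  uncontrolled flow.
\<close>

locale observed_dissipative_flow = hilbert_contraction_semigroup S
  for S :: "real \<Rightarrow> 'a::{real_inner, banach} \<Rightarrow> 'a" +
  fixes F :: "'a \<Rightarrow> 'a" and p :: "'a \<Rightarrow> real" and b \<delta> T r :: real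
  assumes b: "b \<ge> 0" and \<delta>: "\<delta> > 0" and T: "T > 0" and r: "r < 2"
    and F_lipschitz: "\<And>R. R > 0 \<Longrightarrow> \<exists>L\<ge>0. \<forall>x y. norm x \<le> R \<longrightarrow> norm y \<le> R \<longrightarrow>
      norm (F x - F y) \<le> L * norm (x - y)"
    and F_dissipative: "\<And>x. inner x (F x) \<le> - ((p x)\<^sup>2 / norm x powr r)"
    and F_bound: "\<And>x. norm (F x) \<le> b * p x * norm x powr (1 - r)"
    and p_nonneg: "\<And>x. p x \<ge> 0"
    and p_diff: "\<And>x y. \<bar>p x - p y\<bar> \<le> b * (norm x + norm y) * norm (x - y)"
    and observable: "\<And>y. \<delta> * (norm y)\<^sup>2 \<le> integral {0..T} (\<lambda>t. p (S t y))"
begin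

lemma inner_F_nonpos: "inner x (F x) \<le> 0"
  using F_dissipative[of x] by (smt (verit) divide_nonneg_nonneg powr_ge_zero zero_le_power2)

lemma continuous_on_F: "continuous_on X F"
proof -
  have "isCont F x" for x
  proof -
    obtain L where L: "L \<ge> 0" "\<And>u v. norm u \<le> norm x + 1 \<Longrightarrow> norm v \<le> norm x + 1 \<Longrightarrow>
        norm (F u - F v) \<le> L * norm (u - v)"
      using F_lipschitz[of "norm x + 1"] by (auto simp: add_nonneg_pos)
    have "continuous_on (ball 0 (norm x + 1)) F"
      by (rule lipschitz_on_continuous_on[of L]) (auto intro!: lipschitz_onI L simp: dist_norm)
    then show ?thesis by (simp add: continuous_on_eq_continuous_at)
  qed
  then show ?thesis by (simp add: continuous_at_imp_continuous_on)
qed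

lemma continuous_on_p: "continuous_on X p"
proof -
  have "(p \<longlongrightarrow> p x) (at x)" for x
  proof -
    have "((\<lambda>y. b * (norm y + norm x) * norm (y - x)) \<longlongrightarrow> 0) (at x)"
      by (auto intro!: tendsto_eq_intros)
    then have "((\<lambda>y. p y - p x) \<longlongrightarrow> 0) (at x)"
      by (rule Lim_null_comparison[rotated]) (simp add: p_diff)
    then show ?thesis by (simp add: LIM_zero_iff)
  qed
  then show ?thesis by (simp add: continuous_at_imp_continuous_on isCont_def)
qed

lemma trajectory_norm_decreasing:
  assumes "mild (\<lambda>t. F (z t)) z0 z" "0 \<le> s" "s \<le> t"
  shows "norm (z t) \<le> norm (z s)"
  by (rule dissipative_norm_decreasing[OF assms(1) inner_F_nonpos assms(2,3)])

text \<open>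
  Either the norm is halved during the window, and the claim holds for small \<open>\<kappa>\<close>; or it is comparable
  with its initial value \<open>n\<close> throughout. In the second case let \<open>P\<close> be the integral of \<open>p\<close> along the
  trajectory. The trajectory deviates from the uncontrolled one by a multiple of \<open>n powr (1 - r) * P\<close>,
  so observability gives \<open>c n\<^sup>2 \<le> P\<close>. The energy inequality bounds the loss of squared norm from below
  by a multiple of the integral of \<open>p\<^sup>2 / n powr r\<close>, hence by a multiple of \<open>n powr (4 - r)\<close>.
\<close>

lemma window_contraction:
  assumes "N > 0"
  shows "\<exists>\<kappa>>0. \<forall>z0 z a. mild (\<lambda>t. F (z t)) z0 z \<longrightarrow> a \<ge> 0 \<longrightarrow> norm (z a) \<le> N \<longrightarrow>
    (norm (z (a + T)))\<^sup>2 \<le> (norm (z a))\<^sup>2 * (1 - \<kappa> * norm (z a) powr (2 - r))"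
proof -
  \<comment> \<open>K1 and K2 are the costs of replacing powers of the norm along the window; M absorbs the
    deviation from the uncontrolled trajectory. The first entry of the minimum in kappa is for
    the case in which the norm is halved.\<close>
  define K1 K2 where "K1 = 2 powr \<bar>1 - r\<bar>" and "K2 = 2 powr \<bar>r\<bar>"
  define M where "M = 1 + 2 * b\<^sup>2 * K1 * T * N powr (2 - r)"
  define c where "c = \<delta> / M"
  have K: "K1 > 0" "K2 > 0" by (simp_all add: K1_def K2_def)
  have M: "M > 0" using b T K by (auto simp: M_def intro!: add_pos_nonneg)
  have c: "c > 0" using \<delta> M by (simp add: c_def)
  define \<kappa> where "\<kappa> = min (3 / (4 * N powr (2 - r))) (2 * c\<^sup>2 / (K2 * T))"
  have "\<kappa> > 0" using assms c K T by (simp add: \<kappa>_def)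
  moreover have "(norm (z (a + T)))\<^sup>2 \<le> (norm (z a))\<^sup>2 * (1 - \<kappa> * norm (z a) powr (2 - r))"
    if z: "mild (\<lambda>t. F (z t)) z0 z" and a: "a \<ge> 0" and N: "norm (z a) \<le> N" for z0 z a
  proof (cases "norm (z (a + T)) \<le> norm (z a) / 2")
    case True
    have "\<kappa> * norm (z a) powr (2 - r) \<le> 3 / (4 * N powr (2 - r)) * N powr (2 - r)"
      using assms N r \<open>\<kappa> > 0\<close> by (intro mult_mono powr_mono2) (auto simp: \<kappa>_def)
    also have "\<dots> = 3 / 4" using assms by simp
    finally have "(norm (z a))\<^sup>2 * (1 / 4) \<le> (norm (z a))\<^sup>2 * (1 - \<kappa> * norm (z a) powr (2 - r))"
      by (intro mult_left_mono) auto
    moreover have "(norm (z (a + T)))\<^sup>2 \<le> (norm (z a) / 2)\<^sup>2"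
      using True by (intro power_mono) auto
    ultimately show ?thesis by (simp add: power_divide)
  next
    case False
    define n where "n = norm (z a)"
    have "n > 0" using False norm_ge_zero[of "z (a + T)"] trajectory_norm_decreasing[OF z a, of "a + T"] T
      unfolding n_def by linarith
    have window: "n / 2 \<le> norm (z s)" "norm (z s) \<le> n" if "s \<in> {a..a + T}" for s
      using that a False trajectory_norm_decreasing[OF z, of a s]
        trajectory_norm_decreasing[OF z, of s "a + T"] by (auto simp: n_def)
    have contz: "continuous_on {a..c} z" for c
      using continuous_on_mild[OF z] by (rule continuous_on_subset) (use a in auto)
    have contp: "continuous_on {a..c} (\<lambda>s. p (z s))" for c
      by (rule continuous_on_compose2[OF continuous_on_p contz]) auto
    have contF: "continuous_on {a..c} (\<lambda>s. F (z s))" for c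
      by (rule continuous_on_compose2[OF continuous_on_F contz]) auto
    define P where "P = integral {a..a + T} (\<lambda>s. p (z s))"
    have P: "((\<lambda>s. p (z (a + s))) has_integral P) {0..T}"
    proof -
      have "((\<lambda>s. p (z s)) has_integral P) (cbox a (a + T))"
        using integrable_integral[OF integrable_continuous_real[OF contp]] by (simp add: P_def)
      from has_integral_affinity'[OF this, of 1 a] show ?thesis by (simp add: add.commute)
    qed
    define E where "E = b * K1 * n powr (1 - r) * P"
    \<comment> \<open>E bounds the distance to the uncontrolled trajectory that starts from z a.\<close>
    have deviation: "norm (z (a + s) - S s (z a)) \<le> E" if s: "s \<in> {0..T}" for s
    proof -
      have "z (a + s) - S s (z a) = duhamel (\<lambda>s. F (z s)) a (a + s)"
        using mild_restart[OF z a, of "a + s"] s by simp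
      also have "norm \<dots> \<le> integral {a..a + s} (\<lambda>s. b * K1 * n powr (1 - r) * p (z s))"
      proof (rule norm_duhamel_le)
        fix t assume t: "t \<in> {a..a + s}"
        have "norm (z t) powr (1 - r) \<le> K1 * n powr (1 - r)"
          unfolding K1_def using \<open>n > 0\<close> window t s by (intro powr_le_on_dyadic_window) auto
        then have "b * p (z t) * norm (z t) powr (1 - r) \<le> b * p (z t) * (K1 * n powr (1 - r))"
          using b p_nonneg by (intro mult_left_mono) auto
        with F_bound[of "z t"] show "norm (F (z t)) \<le> b * K1 * n powr (1 - r) * p (z t)"
          by (simp add: mult_ac)
      qed (auto intro!: integrable_continuous_real continuous_intros contp contF)
      also have "\<dots> = b * K1 * n powr (1 - r) * integral {a..a + s} (\<lambda>s. p (z s))" by simp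
      also have "integral {a..a + s} (\<lambda>s. p (z s)) \<le> P"
        unfolding P_def using s p_nonneg
        by (intro integral_subset_le integrable_continuous_real contp) auto
      finally show ?thesis
        using b K by (simp add: E_def mult_left_mono)
    qed
    have "\<delta> * n\<^sup>2 \<le> integral {0..T} (\<lambda>s. p (S s (z a)))"
      using observable by (simp add: n_def)
    also have "\<dots> \<le> integral {0..T} (\<lambda>s. p (z (a + s)) + b * (2 * n) * E)"
    proof (rule Henstock_Kurzweil_Integration.integral_le)
      show "(\<lambda>s. p (S s (z a))) integrable_on {0..T}"
        by (intro integrable_continuous_real continuous_on_compose2[OF continuous_on_p] continuous_intros) auto
      show "(\<lambda>s. p (z (a + s)) + b * (2 * n) * E) integrable_on {0..T}"
        using P by (intro integrable_add) auto
      fix s assume s: "s \<in> {0..T}"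
      have "\<bar>p (S s (z a)) - p (z (a + s))\<bar>
          \<le> b * (norm (S s (z a)) + norm (z (a + s))) * norm (z (a + s) - S s (z a))"
        using p_diff[of "S s (z a)" "z (a + s)"] by (simp add: norm_minus_commute)
      also have "\<dots> \<le> b * (n + n) * E"
        using b s norm_le[of s "z a"] window[of "a + s"] \<open>n > 0\<close>
        by (intro mult_mono add_mono deviation) (auto simp: n_def)
      finally show "p (S s (z a)) \<le> p (z (a + s)) + b * (2 * n) * E" by simp
    qed
    also have "\<dots> = P + b * (2 * n) * E * T"
    proof -
      have "((\<lambda>s. p (z (a + s)) + b * (2 * n) * E) has_integral P + (T - 0) *\<^sub>R (b * (2 * n) * E)) {0..T}"
        using P has_integral_const_real[of "b * (2 * n) * E" 0 T] T by (intro has_integral_add) auto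
      then show ?thesis by (simp add: integral_unique)
    qed
    also have "\<dots> = P * (1 + 2 * b\<^sup>2 * K1 * T * n powr (2 - r))"
    proof -
      have "n powr (2 - r) = n * n powr (1 - r)"
        using powr_mult_base[of n "1 - r"] \<open>n > 0\<close> by (simp add: add.commute)
      then show ?thesis by (simp add: E_def power2_eq_square algebra_simps)
    qed
    also have "\<dots> \<le> P * M"
    proof (rule mult_left_mono)
      have "n powr (2 - r) \<le> N powr (2 - r)"
        using N r \<open>n > 0\<close> by (intro powr_mono2) (auto simp: n_def)
      then show "1 + 2 * b\<^sup>2 * K1 * T * n powr (2 - r) \<le> M"
        unfolding M_def using T K by (intro add_left_mono mult_left_mono) auto
      show "P \<ge> 0" using has_integral_nonneg[OF P] p_nonneg by simp
    qed
    finally have lower: "c * n\<^sup>2 \<le> P" using M by (simp add: c_def pos_divide_le_eq)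
    \<comment> \<open>mu is the lower bound for the mean of p over the window. The pointwise inequality
      p^2 >= 2 mu p - mu^2, sharp at p = mu, does the work of the Cauchy-Schwarz inequality.\<close>
    define \<mu> where "\<mu> = c * n\<^sup>2 / T"
    have energy: "(norm (z (a + T)))\<^sup>2 \<le> n\<^sup>2 + integral {a..a + T} (\<lambda>s. 2 * inner (z s) (F (z s)))"
      unfolding n_def using energy_inequality[OF z a, of "a + T"] T by simp
    also have "integral {a..a + T} (\<lambda>s. 2 * inner (z s) (F (z s)))
        \<le> integral {a..a + T} (\<lambda>s. (2 / (K2 * n powr r)) * (\<mu>\<^sup>2 - 2 * \<mu> * p (z s)))"
    proof (rule Henstock_Kurzweil_Integration.integral_le)
      fix s assume s: "s \<in> {a..a + T}"
      have "norm (z s) powr r \<le> K2 * n powr r"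
        unfolding K2_def using \<open>n > 0\<close> window[OF s] by (intro powr_le_on_dyadic_window) auto
      moreover have "norm (z s) powr r > 0" using window[OF s] \<open>n > 0\<close> by auto
      ultimately have "(p (z s))\<^sup>2 / (K2 * n powr r) \<le> (p (z s))\<^sup>2 / norm (z s) powr r"
        using K \<open>n > 0\<close> by (intro divide_left_mono mult_pos_pos) auto
      then have "2 * inner (z s) (F (z s)) \<le> (2 / (K2 * n powr r)) * (- (p (z s))\<^sup>2)"
        using F_dissipative[of "z s"] by simp
      also have "\<dots> \<le> (2 / (K2 * n powr r)) * (\<mu>\<^sup>2 - 2 * \<mu> * p (z s))"
      proof (rule mult_left_mono)
        show "- (p (z s))\<^sup>2 \<le> \<mu>\<^sup>2 - 2 * \<mu> * p (z s)"
          using zero_le_power2[of "p (z s) - \<mu>"] by (simp add: power2_diff mult_ac)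
      qed (use K in auto)
      finally show "2 * inner (z s) (F (z s)) \<le> (2 / (K2 * n powr r)) * (\<mu>\<^sup>2 - 2 * \<mu> * p (z s))" .
    next
      show "(\<lambda>s. 2 * inner (z s) (F (z s))) integrable_on {a..a + T}"
        by (intro integrable_continuous_real continuous_intros contz contF)
      show "(\<lambda>s. (2 / (K2 * n powr r)) * (\<mu>\<^sup>2 - 2 * \<mu> * p (z s))) integrable_on {a..a + T}"
        by (intro integrable_continuous_real continuous_intros contp)
    qed
    also have "\<dots> = (2 / (K2 * n powr r)) * (\<mu>\<^sup>2 * T - 2 * \<mu> * P)"
    proof -
      have "((\<lambda>s. \<mu>\<^sup>2 - 2 * \<mu> * p (z s)) has_integral ((a + T) - a) *\<^sub>R \<mu>\<^sup>2 - 2 * \<mu> * P) {a..a + T}"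
        using T has_integral_const_real[of "\<mu>\<^sup>2" a "a + T"]
          integrable_integral[OF integrable_continuous_real[OF contp[of "a + T"]]]
        by (intro has_integral_diff has_integral_mult_right) (auto simp: P_def)
      then have "((\<lambda>s. (2 / (K2 * n powr r)) * (\<mu>\<^sup>2 - 2 * \<mu> * p (z s))) has_integral
          (2 / (K2 * n powr r)) * (((a + T) - a) *\<^sub>R \<mu>\<^sup>2 - 2 * \<mu> * P)) {a..a + T}"
        by (rule has_integral_mult_right)
      then have "integral {a..a + T} (\<lambda>s. (2 / (K2 * n powr r)) * (\<mu>\<^sup>2 - 2 * \<mu> * p (z s)))
          = (2 / (K2 * n powr r)) * (((a + T) - a) *\<^sub>R \<mu>\<^sup>2 - 2 * \<mu> * P)"
        by (rule integral_unique)
      also have "((a + T) - a) *\<^sub>R \<mu>\<^sup>2 = \<mu>\<^sup>2 * T" by simp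
      finally show ?thesis .
    qed
    also have "\<dots> \<le> (2 / (K2 * n powr r)) * (\<mu>\<^sup>2 * T - 2 * \<mu> * (c * n\<^sup>2))"
      using lower c T K by (intro mult_left_mono diff_left_mono) (auto simp: \<mu>_def)
    also have "\<dots> = - (n\<^sup>2 * (2 * c\<^sup>2 / (K2 * T) * n powr (2 - r)))"
    proof -
      have "\<mu>\<^sup>2 * T = \<mu> * (c * n\<^sup>2)" using T by (simp add: \<mu>_def power2_eq_square)
      then have "\<mu>\<^sup>2 * T - 2 * \<mu> * (c * n\<^sup>2) = - (c\<^sup>2 * n\<^sup>2 * n\<^sup>2 / T)"
        by (simp add: \<mu>_def power2_eq_square)
      moreover have "n powr (2 - r) = n\<^sup>2 / n powr r" using \<open>n > 0\<close> by (simp add: powr_diff)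
      ultimately show ?thesis by (simp add: mult_ac)
    qed
    also have "\<dots> \<le> - (n\<^sup>2 * (\<kappa> * n powr (2 - r)))"
      unfolding neg_le_iff_le by (intro mult_left_mono mult_right_mono) (auto simp: \<kappa>_def)
    finally show ?thesis by (simp add: n_def algebra_simps)
  qed
  ultimately show ?thesis by blast
qed

text \<open>
  Sampling the norm at multiples of \<open>T\<close> gives the recursion of
  \<open>powr_growth_of_recursive_decay\<close> with \<open>\<gamma> = 2 - r\<close>; monotonicity fills in the times between. The
  constant \<open>\<kappa>\<close> can be kept along the trajectory because it depends only on a bound for the norm.
\<close>

lemma trajectory_decay:
  assumes z: "mild (\<lambda>t. F (z t)) z0 z"
  shows "\<exists>C. eventually (\<lambda>t. norm (z t) \<le> C * t powr (- (1 / (2 - r)))) at_top"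
proof (cases "\<exists>t\<ge>0. z t = 0")
  case True
  then obtain t0 where t0: "t0 \<ge> 0" "z t0 = 0" by blast
  have "eventually (\<lambda>t. norm (z t) \<le> 0 * t powr (- (1 / (2 - r)))) at_top"
    using eventually_ge_at_top[of t0]
  proof eventually_elim
    case (elim t)
    then show ?case using trajectory_norm_decreasing[OF z t0(1) elim] t0 by simp
  qed
  then show ?thesis by blast
next
  case False
  define \<gamma> where "\<gamma> = 2 - r"
  define n where "n k = norm (z (real k * T))" for k
  have npos: "n k > 0" for k using False T by (auto simp: n_def)
  have n_le: "n k \<le> n 0" for k
    unfolding n_def using T by (intro trajectory_norm_decreasing[OF z]) auto
  obtain \<kappa> where \<kappa>: "\<kappa> > 0" and contr: "\<And>a. a \<ge> 0 \<Longrightarrow> norm (z a) \<le> n 0 \<Longrightarrow>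
      (norm (z (a + T)))\<^sup>2 \<le> (norm (z a))\<^sup>2 * (1 - \<kappa> * norm (z a) powr (2 - r))"
    using window_contraction[OF npos[of 0]] z by blast
  have rec: "(n (Suc k))\<^sup>2 \<le> (n k)\<^sup>2 * (1 - \<kappa> * n k powr \<gamma>)" for k
    using contr[of "real k * T"] n_le[of k] T by (simp add: n_def \<gamma>_def algebra_simps)
  have \<gamma>: "\<gamma> > 0" using r by (simp add: \<gamma>_def)
  define c where "c = \<gamma> * \<kappa> / (4 * T)"
  have c: "c > 0" using \<gamma> \<kappa> T by (simp add: c_def)
  have "eventually (\<lambda>t. norm (z t) \<le> c powr (- (1 / \<gamma>)) * t powr (- (1 / \<gamma>))) at_top"
    using eventually_ge_at_top[of "2 * T"]
  proof eventually_elim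
    case (elim t)
    \<comment> \<open>The number of complete windows before t. It is at least t / (2 T) once t >= 2 T, which
      accounts for the factor 4 in c.\<close>
    define k where "k = nat \<lfloor>t / T\<rfloor>"
    have t: "t > 0" "t / T \<ge> 2" using elim T by (auto simp: field_simps)
    have k: "real k \<le> t / T" "t / T < real k + 1"
      using t by (auto simp: k_def)
    have "real k * T \<le> t" using k T by (simp add: field_simps)
    then have "norm (z t) \<le> n k"
      unfolding n_def using T by (intro trajectory_norm_decreasing[OF z]) auto
    also have "n k = (n k powr - \<gamma>) powr (- (1 / \<gamma>))"
      using \<gamma> npos[of k] by (simp add: powr_powr)
    also have "\<dots> \<le> (c * t) powr (- (1 / \<gamma>))"
    proof (rule powr_mono2')
      have "c * t = \<gamma> * \<kappa> / 2 * (t / T / 2)" using T by (simp add: c_def)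
      also have "\<dots> \<le> \<gamma> * \<kappa> / 2 * k"
        using k t \<gamma> \<kappa> by (intro mult_left_mono) auto
      also have "\<dots> \<le> n k powr - \<gamma>"
        by (rule powr_growth_of_recursive_decay[of \<kappa> \<gamma> n, OF \<kappa> \<gamma> npos rec])
      finally show "c * t \<le> n k powr - \<gamma>" .
    qed (use c t \<gamma> in auto)
    also have "\<dots> = c powr (- (1 / \<gamma>)) * t powr (- (1 / \<gamma>))"
      using c t by (simp add: powr_mult)
    finally show ?case .
  qed
  then show ?thesis unfolding \<gamma>_def by blast
qed

lemma trajectory_exists: "\<exists>z. mild (\<lambda>t. F (z t)) z0 z"
  by (rule dissipative_mild_solution_exists[OF F_lipschitz inner_F_nonpos])

lemma trajectory_unique:
  assumes "mild (\<lambda>t. F (z t)) z0 z" "mild (\<lambda>t. F (w t)) z0 w" "t \<ge> 0"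
  shows "z t = w t"
  by (rule dissipative_mild_solution_unique[OF F_lipschitz inner_F_nonpos assms])

end

section \<open>The feedback field\<close>

lemma conj_of_real: "conj (of_real c :: 'k::conj_field) = of_real c"
  by (simp add: of_real_def conj_scaleR_one)

lemma norm_conj: "norm (conj a) = norm (a :: 'k::conj_field)"
proof (cases "a = 0")
  case True
  then show ?thesis using conj_of_real[of 0, where 'k = 'k] by simp
next
  case False
  have "norm a * norm (conj a) = norm a * norm a"
    using arg_cong[OF mult_conj[of a], of norm] by (simp add: norm_mult power2_eq_square)
  with False show ?thesis by simp
qed

context hilbert_space
begin

lemma ip_add_right: "ip x (y + w) = ip x y + ip x w"
  by (metis ip_add_left ip_commute conj_add)

lemma ip_diff_left: "ip (x - y) w = ip x w - ip y w"
  using ip_add_left[of "x - y" y w] by simp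

lemma ip_diff_right: "ip x (y - w) = ip x y - ip x w"
  using ip_add_right[of x "y - w" w] by simp

lemma norm_ip_commute: "norm (ip x y) = norm (ip y x)"
  by (metis ip_commute norm_conj)

text \<open>
  The link between the norm and scalars of type \<open>'k\<close> is the diagonal of \<open>ip\<close>, so homogeneity is
  computed there.
\<close>

lemma norm_scal: "norm (scal a x) = norm a * norm x"
proof -
  have "ip (scal a x) (scal a x) = (a * conj a) * ip x x"
  proof -
    have "ip x (scal a x) = conj a * conj (ip x x)"
      by (metis ip_commute ip_scale_left conj_mult)
    then show ?thesis using ip_commute[of x x] by (simp add: ip_scale_left)
  qed
  then have "of_real ((norm (scal a x))\<^sup>2) = (of_real ((norm a * norm x)\<^sup>2) :: 'k)"
    by (simp add: ip_self mult_conj of_real_def power_mult_distrib)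
  then have "(norm (scal a x))\<^sup>2 = (norm a * norm x)\<^sup>2" by (simp only: of_real_eq_iff)
  then show ?thesis by (simp add: power2_eq_iff_nonneg)
qed

text \<open>
  Rotating \<open>x\<close> by the conjugate of \<open>ip x y\<close> makes the inner product with \<open>y\<close> real, so that the
  Cauchy-Schwarz inequality for the real part applies.
\<close>

lemma norm_ip_le: "norm (ip x y) \<le> norm x * norm y"
proof (cases "ip x y = 0")
  case False
  define c where "c = ip x y"
  have "ip (scal (conj c) x) y = of_real ((norm c)\<^sup>2)"
    by (simp add: ip_scale_left c_def mult.commute mult_conj of_real_def)
  moreover from this have "ip y (scal (conj c) x) = of_real ((norm c)\<^sup>2)"
    by (metis conj_of_real ip_commute)
  ultimately have "(of_real (2 * inner (scal (conj c) x) y) :: 'k) = of_real (2 * (norm c)\<^sup>2)"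
    unfolding inner_is_real_part by simp
  then have "(norm c)\<^sup>2 = inner (scal (conj c) x) y" by (simp only: of_real_eq_iff)
  also have "\<dots> \<le> norm (scal (conj c) x) * norm y" by (rule norm_cauchy_schwarz)
  also have "\<dots> = norm c * (norm x * norm y)" by (simp add: norm_scal norm_conj)
  finally show ?thesis using False by (simp add: c_def power2_eq_square)
qed simp

lemma norm_quadratic_form_diff_le:
  assumes "bounded_linear B" and b: "\<And>x. norm (B x) \<le> b * norm x" and "b \<ge> 0"
  shows "norm (ip x (B x) - ip y (B y)) \<le> b * (norm x + norm y) * norm (x - y)"
proof -
  have "ip x (B x) - ip y (B y) = ip (x - y) (B x) + ip y (B (x - y))"
    by (simp add: ip_diff_left ip_diff_right linear_diff[OF bounded_linear.linear[OF assms(1)]])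
  also have "norm \<dots> \<le> norm (x - y) * norm (B x) + norm y * norm (B (x - y))"
    by (intro norm_triangle_mono norm_ip_le)
  also have "\<dots> \<le> norm (x - y) * (b * norm x) + norm y * (b * norm (x - y))"
    by (intro add_mono mult_left_mono b) auto
  finally show ?thesis by (simp add: algebra_simps)
qed

text \<open>
  The nonlinearity of the closed loop, so that the closed-loop equation is \<open>z' = A z + F z\<close>.
\<close>

definition feedback_field :: "('h \<Rightarrow> 'h) \<Rightarrow> real \<Rightarrow> 'h \<Rightarrow> 'h" where
  "feedback_field B r x = scal (feedback ip B r x) (B x)"

text \<open>
  The case distinction in the feedback disappears, since \<open>0 powr - r = 0\<close>.
\<close>

lemma feedback_field_eq:
  "feedback_field B r x = - (norm x powr - r) *\<^sub>R scal (ip x (B x)) (B x)"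
proof (cases "x = 0")
  case False
  have "feedback ip B r x = of_real (- (norm x powr - r)) * ip x (B x)"
    using False by (simp add: feedback_def powr_minus field_simps)
  then show ?thesis
    by (simp only: feedback_field_def scale_of_real flip: scale_scale)
qed (simp add: feedback_field_def feedback_def)

lemma inner_feedback_field:
  "inner x (feedback_field B r x) = - ((norm (ip x (B x)))\<^sup>2 / norm x powr r)"
proof -
  let ?c = "ip x (B x)"
  have "ip (scal ?c (B x)) x = of_real ((norm ?c)\<^sup>2)"
    by (simp only: ip_scale_left ip_commute[of "B x" x] mult_conj of_real_def)
  moreover from this have "ip x (scal ?c (B x)) = of_real ((norm ?c)\<^sup>2)"
    by (metis conj_of_real ip_commute)
  ultimately have "(of_real (2 * inner x (scal ?c (B x))) :: 'k) = of_real (2 * (norm ?c)\<^sup>2)"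
    unfolding inner_is_real_part by simp
  then have "inner x (scal ?c (B x)) = (norm ?c)\<^sup>2" by (simp only: of_real_eq_iff)
  then show ?thesis by (simp add: feedback_field_eq powr_minus field_simps)
qed

lemma norm_feedback_field_le:
  assumes b: "\<And>x. norm (B x) \<le> b * norm x"
  shows "norm (feedback_field B r x) \<le> b * norm (ip x (B x)) * norm x powr (1 - r)"
proof -
  have "norm (feedback_field B r x) = norm x powr - r * (norm (ip x (B x)) * norm (B x))"
    by (simp add: feedback_field_eq norm_scal)
  also have "\<dots> \<le> norm x powr - r * (norm (ip x (B x)) * (b * norm x))"
    by (intro mult_left_mono b) auto
  also have "\<dots> = b * norm (ip x (B x)) * (norm x powr - r * norm x)" by simp
  also have "norm x powr - r * norm x = norm x powr (1 - r)"
    by (cases "x = 0") (auto simp: powr_diff powr_minus field_simps)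
  finally show ?thesis .
qed

text \<open>
  Without the factor \<open>norm z powr - r\<close> the field is cubic, with increments of order \<open>(norm x)\<^sup>2\<close>
  where \<open>x\<close> is the larger of the two vectors. The factor then costs \<open>norm x powr - r\<close>, and its own
  increments are absorbed by the cubic term of the smaller vector. The total degree \<open>2 - r\<close> is
  positive, which gives the bound in terms of \<open>R\<close>.
\<close>

lemma feedback_field_lipschitz:
  assumes lin: "bounded_linear B" and b: "\<And>x. norm (B x) \<le> b * norm x" "b \<ge> 0"
    and "r < 2" "norm x \<le> R" "norm y \<le> R"
  shows "norm (feedback_field B r x - feedback_field B r y)
    \<le> (3 + \<bar>r\<bar>) * b\<^sup>2 * R powr (2 - r) * norm (x - y)"
proof -
  have ordered: "norm (feedback_field B r x - feedback_field B r y)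
      \<le> (3 + \<bar>r\<bar>) * b\<^sup>2 * R powr (2 - r) * norm (x - y)"
    if le: "norm y \<le> norm x" "norm x \<le> R" for x y
  proof (cases "x = 0")
    case True
    with le show ?thesis by simp
  next
    case False
    define G where "G v = scal (ip v (B v)) (B v)" for v
    define m where "m = norm x powr - r"
    have boundG: "norm (G y) \<le> b\<^sup>2 * norm y ^ 3"
    proof -
      have "norm (G y) \<le> (norm y * (b * norm y)) * (b * norm y)"
        unfolding G_def norm_scal
        by (intro mult_mono b order_trans[OF norm_ip_le] mult_left_mono) (use b in auto)
      then show ?thesis by (simp add: power2_eq_square power3_eq_cube mult_ac)
    qed
    have diffG: "norm (G x - G y) \<le> 3 * b\<^sup>2 * (norm x)\<^sup>2 * norm (x - y)"
    proof -
      have "G x - G y = scal (ip x (B x) - ip y (B y)) (B x) + scal (ip y (B y)) (B (x - y))"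
        by (simp add: G_def scale_left_diff_distrib scale_right_diff_distrib
            linear_diff[OF bounded_linear.linear[OF lin]])
      also have "norm \<dots> \<le> (b * (norm x + norm y) * norm (x - y)) * (b * norm x)
          + (norm y * (b * norm y)) * (b * norm (x - y))"
      proof (intro norm_triangle_mono; unfold norm_scal; rule mult_mono)
        show "norm (ip x (B x) - ip y (B y)) \<le> b * (norm x + norm y) * norm (x - y)"
          by (rule norm_quadratic_form_diff_le[OF lin b])
        show "norm (ip y (B y)) \<le> norm y * (b * norm y)"
          by (rule order_trans[OF norm_ip_le]) (intro mult_left_mono b norm_ge_zero)
      qed (use b in auto)
      also have "\<dots> \<le> (b * (norm x + norm x) * norm (x - y)) * (b * norm x)
          + (norm x * (b * norm x)) * (b * norm (x - y))"
        using le b by (intro add_mono mult_mono) auto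
      finally show ?thesis by (simp add: power2_eq_square algebra_simps)
    qed
    have "feedback_field B r x - feedback_field B r y
        = - (m *\<^sub>R (G x - G y) + (m - norm y powr - r) *\<^sub>R G y)"
      by (simp add: feedback_field_eq G_def m_def algebra_simps)
    then have "norm (feedback_field B r x - feedback_field B r y)
        \<le> m * norm (G x - G y) + \<bar>m - norm y powr - r\<bar> * norm (G y)"
      using norm_triangle_ineq[of "m *\<^sub>R (G x - G y)" "(m - norm y powr - r) *\<^sub>R G y"]
      by (simp only: norm_minus_cancel norm_scaleR) (simp add: m_def)
    also have "\<dots> \<le> m * (3 * b\<^sup>2 * (norm x)\<^sup>2 * norm (x - y))
        + \<bar>m - norm y powr - r\<bar> * (b\<^sup>2 * norm y ^ 3)"
      by (intro add_mono mult_left_mono boundG diffG) (auto simp: m_def)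
    also have "m * (3 * b\<^sup>2 * (norm x)\<^sup>2 * norm (x - y)) = 3 * b\<^sup>2 * norm x powr (2 - r) * norm (x - y)"
    proof -
      have eq: "m * (norm x)\<^sup>2 = norm x powr (2 - r)"
        using False by (simp add: m_def powr_diff powr_minus field_simps)
      then show ?thesis by (simp add: mult_ac flip: eq)
    qed
    also have "\<bar>m - norm y powr - r\<bar> * (b\<^sup>2 * norm y ^ 3) \<le> b\<^sup>2 * (\<bar>r\<bar> * norm x powr (2 - r) * norm (x - y))"
    proof (cases "y = 0")
      case False
      have "\<bar>m - norm y powr - r\<bar> * norm y ^ 3 \<le> \<bar>r\<bar> * norm x powr (2 - r) * (norm x - norm y)"
        unfolding m_def using False le \<open>r < 2\<close> by (intro powr_minus_diff_bound) auto
      also have "\<dots> \<le> \<bar>r\<bar> * norm x powr (2 - r) * norm (x - y)"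
        by (intro mult_left_mono norm_triangle_ineq2) auto
      finally have "b\<^sup>2 * (\<bar>m - norm y powr - r\<bar> * norm y ^ 3)
          \<le> b\<^sup>2 * (\<bar>r\<bar> * norm x powr (2 - r) * norm (x - y))"
        by (intro mult_left_mono) auto
      then show ?thesis by (simp add: mult_ac)
    qed auto
    finally have "norm (feedback_field B r x - feedback_field B r y)
        \<le> (3 + \<bar>r\<bar>) * b\<^sup>2 * norm (x - y) * norm x powr (2 - r)"
      by (simp add: algebra_simps)
    also have "\<dots> \<le> (3 + \<bar>r\<bar>) * b\<^sup>2 * norm (x - y) * R powr (2 - r)"
      using le \<open>r < 2\<close> by (intro mult_left_mono powr_mono2) auto
    finally show ?thesis by (simp add: mult_ac)
  qed
  show ?thesis
    using ordered[of y x] ordered[of x y] assms(5,6)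
    by (cases "norm y \<le> norm x") (auto simp: norm_minus_commute)
qed

end

section \<open>Complete inner product spaces as Banach spaces\<close>

text \<open>
  Existence of integrals of continuous functions is a fact about the type class \<open>banach\<close>. Classes
  are nominal: a type of sort \<open>{real_inner, complete_space}\<close> has all the properties of a Banach space
  without belonging to that class. The isometric copy below does belong to it, and integrals and
  limits are carried back and forth by the linear isometries \<open>wrap\<close> and \<open>unwrap\<close>.
\<close>

typedef (overloaded) 'a hilbert = "UNIV :: 'a::{real_inner, complete_space} set"
  morphisms unwrap wrap by simp

lemma unwrap_wrap [simp]: "unwrap (wrap x) = x"
  by (simp add: wrap_inverse)

lemma hilbert_eq_iff: "x = y \<longleftrightarrow> unwrap x = unwrap y"
  by (simp add: unwrap_inject)

instantiation hilbert :: ("{real_inner, complete_space}") dist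
begin
definition dist_hilbert :: "'a hilbert \<Rightarrow> 'a hilbert \<Rightarrow> real"
  where "dist x y = dist (unwrap x) (unwrap y)"
instance ..
end

instantiation hilbert :: ("{real_inner, complete_space}") uniformity_dist
begin
definition uniformity_hilbert :: "('a hilbert \<times> 'a hilbert) filter"
  where "(uniformity :: ('a hilbert \<times> 'a hilbert) filter) = (INF e\<in>{0<..}. principal {(x, y). dist x y < e})"
instance by standard (rule uniformity_hilbert_def)
end

instantiation hilbert :: ("{real_inner, complete_space}") open_uniformity
begin
definition open_hilbert :: "'a hilbert set \<Rightarrow> bool"
  where "open (U :: 'a hilbert set) \<longleftrightarrow> (\<forall>x\<in>U. eventually (\<lambda>(x', y). x' = x \<longrightarrow> y \<in> U) uniformity)"
instance by standard (rule open_hilbert_def)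
end

instantiation hilbert :: ("{real_inner, complete_space}") real_inner
begin

definition zero_hilbert :: "'a hilbert" where "0 = wrap 0"
definition plus_hilbert :: "'a hilbert \<Rightarrow> 'a hilbert \<Rightarrow> 'a hilbert"
  where "x + y = wrap (unwrap x + unwrap y)"
definition minus_hilbert :: "'a hilbert \<Rightarrow> 'a hilbert \<Rightarrow> 'a hilbert"
  where "x - y = wrap (unwrap x - unwrap y)"
definition uminus_hilbert :: "'a hilbert \<Rightarrow> 'a hilbert" where "- x = wrap (- unwrap x)"
definition scaleR_hilbert :: "real \<Rightarrow> 'a hilbert \<Rightarrow> 'a hilbert"
  where "c *\<^sub>R x = wrap (c *\<^sub>R unwrap x)"
definition inner_hilbert :: "'a hilbert \<Rightarrow> 'a hilbert \<Rightarrow> real"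
  where "inner x y = inner (unwrap x) (unwrap y)"
definition norm_hilbert :: "'a hilbert \<Rightarrow> real" where "norm x = norm (unwrap x)"
definition sgn_hilbert :: "'a hilbert \<Rightarrow> 'a hilbert" where "sgn x = wrap (sgn (unwrap x))"

lemmas hilbert_defs = zero_hilbert_def plus_hilbert_def minus_hilbert_def uminus_hilbert_def
  scaleR_hilbert_def inner_hilbert_def norm_hilbert_def dist_hilbert_def sgn_hilbert_def

instance
  by standard
    (auto simp: hilbert_defs hilbert_eq_iff algebra_simps sgn_div_norm dist_norm
      inner_add_left inner_commute norm_eq_sqrt_inner)

end

lemma unwrap_simps [simp]:
  "unwrap 0 = 0" "unwrap (x + y) = unwrap x + unwrap y" "unwrap (x - y) = unwrap x - unwrap y"
  "unwrap (c *\<^sub>R x) = c *\<^sub>R unwrap x"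
  by (simp_all add: hilbert_defs)

lemma bounded_linear_unwrap: "bounded_linear unwrap"
  by (rule bounded_linear_intro[of _ 1]) (simp_all add: norm_hilbert_def)

lemma bounded_linear_wrap: "bounded_linear wrap"
  by (rule bounded_linear_intro[of _ 1]) (simp_all add: norm_hilbert_def hilbert_eq_iff)

instance hilbert :: ("{real_inner, complete_space}") banach
proof
  fix X :: "nat \<Rightarrow> 'a hilbert"
  assume "Cauchy X"
  then have "Cauchy (\<lambda>n. unwrap (X n))" by (simp add: Cauchy_def dist_hilbert_def)
  then obtain l where "(\<lambda>n. unwrap (X n)) \<longlonglongrightarrow> l"
    using Cauchy_convergent convergent_def by blast
  then have "(\<lambda>n. wrap (unwrap (X n))) \<longlonglongrightarrow> wrap l"
    by (rule bounded_linear.tendsto[OF bounded_linear_wrap])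
  then show "convergent X" by (auto simp: unwrap_inverse convergent_def)
qed

section \<open>Stabilization\<close>

lemma contraction_semigroup_wrapped:
  fixes S :: "real \<Rightarrow> 'h \<Rightarrow> 'h::{real_inner, complete_space}"
  assumes "contraction_C0_semigroup scal S"
  shows "contraction_semigroup (\<lambda>t x. wrap (S t (unwrap x)))"
proof -
  have lin: "bounded_linear (S t)" if "t \<ge> 0" for t
    using assms that by (auto simp: contraction_C0_semigroup_def C0_semigroup_def bounded_operator_def)
  have nonexp: "norm (S t x) \<le> norm x" if "t \<ge> 0" for t x
  proof -
    have "norm (S t x) \<le> onorm (S t) * norm x" by (rule onorm[OF lin[OF that]])
    also have "\<dots> \<le> 1 * norm x"
      using assms that by (intro mult_right_mono) (auto simp: contraction_C0_semigroup_def)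
    finally show ?thesis by simp
  qed
  show ?thesis
  proof (rule contraction_semigroup.intro)
    show "bounded_linear (\<lambda>x. wrap (S t (unwrap x)))" if "t \<ge> 0" for t
      by (intro bounded_linear_compose[OF bounded_linear_wrap]
          bounded_linear_compose[OF lin bounded_linear_unwrap] that)
    show "((\<lambda>t. wrap (S t (unwrap x))) \<longlongrightarrow> x) (at_right 0)" for x
    proof -
      have "((\<lambda>t. S t (unwrap x)) \<longlongrightarrow> unwrap x) (at_right 0)"
        using assms by (auto simp: contraction_C0_semigroup_def C0_semigroup_def)
      from bounded_linear.tendsto[OF bounded_linear_wrap this]
      show ?thesis by (simp add: unwrap_inverse)
    qed
  qed (use assms nonexp in \<open>auto simp: contraction_C0_semigroup_def C0_semigroup_def
      norm_hilbert_def unwrap_inverse\<close>)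
qed

text \<open>
  Both notions of solution state the same integral equation: \<open>wrap\<close> and \<open>unwrap\<close> are bounded linear and
  therefore commute with the integral, and continuity of the field makes the integrand integrable.
\<close>

lemma mild_solution_iff_wrapped:
  fixes S :: "real \<Rightarrow> 'h \<Rightarrow> 'h::{real_inner, complete_space}"
  defines "S' \<equiv> \<lambda>t x. wrap (S t (unwrap x))"
  assumes "contraction_semigroup S'"
    and cont: "continuous_on UNIV (\<lambda>x. wrap (scal (V (unwrap x)) (B (unwrap x))))"
  shows "mild_solution scal S B V z0 z \<longleftrightarrow>
    contraction_semigroup.mild S' (\<lambda>t. wrap (scal (V (z t)) (B (z t)))) (wrap z0) (\<lambda>t. wrap (z t))"
proof -
  interpret contraction_semigroup S' by fact
  let ?f = "\<lambda>s. scal (V (z s)) (B (z s))"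
  have transfer: "((\<lambda>s. S (t - s) (?f s)) has_integral I) {0..t} \<longleftrightarrow>
      ((\<lambda>s. S' (t - s) (wrap (?f s))) has_integral wrap I) {0..t}" for t I
    using has_integral_linear[OF _ bounded_linear_wrap, of "\<lambda>s. S (t - s) (?f s)" I "{0..t}"]
      has_integral_linear[OF _ bounded_linear_unwrap, of "\<lambda>s. S' (t - s) (wrap (?f s))" "wrap I" "{0..t}"]
    by (auto simp: S'_def o_def)
  have contf: "continuous_on {0..} (\<lambda>s. wrap (?f s))" if "continuous_on {0..} (\<lambda>t. wrap (z t))"
    using continuous_on_compose2[OF cont that] by simp
  show ?thesis
  proof
    assume sol: "mild_solution scal S B V z0 z"
    then have "continuous_on {0..} (\<lambda>t. wrap (z t))"
      by (auto simp: mild_solution_def intro: bounded_linear.continuous_on[OF bounded_linear_wrap])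
    then have "continuous_on {0..} (\<lambda>s. wrap (?f s))" by (rule contf)
    moreover have "wrap (z t) = S' t (wrap z0) + duhamel (\<lambda>s. wrap (?f s)) 0 t" if "t \<ge> 0" for t
    proof -
      obtain I where I: "((\<lambda>s. S (t - s) (?f s)) has_integral I) {0..t}" "z t = S t z0 + I"
        using sol \<open>t \<ge> 0\<close> unfolding mild_solution_def by blast
      from I(1) have "duhamel (\<lambda>s. wrap (?f s)) 0 t = wrap I"
        unfolding transfer duhamel_def by (rule integral_unique)
      with I(2) show ?thesis by (simp add: hilbert_eq_iff S'_def)
    qed
    ultimately show "mild (\<lambda>t. wrap (?f t)) (wrap z0) (\<lambda>t. wrap (z t))"
      by (simp add: mild_def)
  next
    assume sol: "mild (\<lambda>t. wrap (?f t)) (wrap z0) (\<lambda>t. wrap (z t))"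
    have "continuous_on {0..} z"
      using bounded_linear.continuous_on[OF bounded_linear_unwrap continuous_on_mild[OF sol]] by simp
    moreover have "((\<lambda>s. S (t - s) (?f s)) has_integral unwrap (duhamel (\<lambda>s. wrap (?f s)) 0 t)) {0..t}"
      if "t \<ge> 0" for t
      unfolding transfer duhamel_def unwrap_inverse
      by (intro integrable_integral integrand_integrable)
        (use sol in \<open>auto simp: mild_def intro: continuous_on_subset\<close>)
    moreover have "z t = S t z0 + unwrap (duhamel (\<lambda>s. wrap (?f s)) 0 t)" if "t \<ge> 0" for t
    proof -
      have "wrap (z t) = S' t (wrap z0) + duhamel (\<lambda>s. wrap (?f s)) 0 t"
        using sol that by (simp add: mild_def)
      then show ?thesis by (simp add: hilbert_eq_iff S'_def)
    qed
    ultimately show "mild_solution scal S B V z0 z" by (auto simp: mild_solution_def)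
  qed
qed

theorem theorem4p5:
  fixes scal :: "'k::conj_field \<Rightarrow> 'h::{real_inner, complete_space} \<Rightarrow> 'h"
    and ip :: "'h \<Rightarrow> 'h \<Rightarrow> 'k"
    and D :: "'h set" and A :: "'h \<Rightarrow> 'h"
    and S :: "real \<Rightarrow> 'h \<Rightarrow> 'h"
    and B :: "'h \<Rightarrow> 'h"
    and \<delta> T r :: real
  assumes "hilbert_space scal ip"
    and "contraction_C0_semigroup scal S" and "generates D A S"
    and "bounded_operator scal B"
    and "\<delta> > 0" and "T > 0"
    and "\<forall>y. integral {0..T} (\<lambda>t. norm (ip (B (S t y)) (S t y))) \<ge> \<delta> * (norm y)\<^sup>2"
    and "r < 2"
  shows "strongly_stabilizes scal S B (feedback ip B r) \<and>
    (\<forall>z0 z. mild_solution scal S B (feedback ip B r) z0 z \<longrightarrow>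
       (\<lambda>t. norm (z t)) \<in> O[at_top](\<lambda>t. t powr (- (1 / (2 - r)))))"
proof -
  interpret H: hilbert_space scal ip by fact
  have lin: "bounded_linear B" using assms(4) by (simp add: bounded_operator_def)
  obtain b where b: "b \<ge> 0" "\<And>x. norm (B x) \<le> b * norm x"
    using bounded_linear.nonneg_bounded[OF lin] by (auto simp: mult.commute)
  let ?V = "feedback ip B r" and ?F = "H.feedback_field B r"
  \<comment> \<open>From here on the dynamics takes place on the isometric copy of the space.\<close>
  define S' where "S' = (\<lambda>t x. wrap (S t (unwrap x)))"
  define F' where "F' x = wrap (?F (unwrap x))" for x
  define p where "p x = norm (ip (unwrap x) (B (unwrap x)))" for x :: "'h hilbert"
  have S': "contraction_semigroup S'"
    unfolding S'_def by (rule contraction_semigroup_wrapped[OF assms(2)])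
  interpret observed_dissipative_flow S' F' p b \<delta> T r
  proof (rule observed_dissipative_flow.intro)
    show "hilbert_contraction_semigroup S'"
      using S' by (rule hilbert_contraction_semigroup.intro)
    show "observed_dissipative_flow_axioms S' F' p b \<delta> T r"
    proof
      show "\<exists>L\<ge>0. \<forall>x y. norm x \<le> R \<longrightarrow> norm y \<le> R \<longrightarrow> norm (F' x - F' y) \<le> L * norm (x - y)" for R
        using H.feedback_field_lipschitz[OF lin b(2,1) assms(8)]
        by (intro exI[of _ "(3 + \<bar>r\<bar>) * b\<^sup>2 * R powr (2 - r)"])
          (auto simp: norm_hilbert_def F'_def)
      show "inner x (F' x) \<le> - ((p x)\<^sup>2 / norm x powr r)" for x
        by (simp add: inner_hilbert_def F'_def p_def norm_hilbert_def H.inner_feedback_field)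
      show "norm (F' x) \<le> b * p x * norm x powr (1 - r)" for x
        using H.norm_feedback_field_le[OF b(2)] by (simp add: F'_def p_def norm_hilbert_def)
      show "\<bar>p x - p y\<bar> \<le> b * (norm x + norm y) * norm (x - y)" for x y
        unfolding p_def norm_hilbert_def unwrap_simps
        by (rule order_trans[OF norm_triangle_ineq3 H.norm_quadratic_form_diff_le[OF lin b(2,1)]])
      show "\<delta> * (norm y)\<^sup>2 \<le> integral {0..T} (\<lambda>t. p (S' t y))" for y
        using assms(7)[rule_format, of "unwrap y"]
        by (simp add: p_def S'_def norm_hilbert_def H.norm_ip_commute[of "B _"])
    qed (use assms b in \<open>auto simp: p_def\<close>)
  qed
  have sol_iff: "mild_solution scal S B ?V z0 z \<longleftrightarrow>
      mild (\<lambda>t. F' (wrap (z t))) (wrap z0) (\<lambda>t. wrap (z t))" for z0 z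
    using mild_solution_iff_wrapped[of S scal ?V B z0 z] S' continuous_on_F[of UNIV]
    by (simp add: F'_def H.feedback_field_def flip: S'_def)
  have decreasing: "norm (z t) \<le> norm z0" if "mild_solution scal S B ?V z0 z" "t \<ge> 0" for z0 z t
    using that trajectory_norm_decreasing[of "\<lambda>t. wrap (z t)" "wrap z0" 0 t]
      mild_initial_value[of _ "wrap z0" "\<lambda>t. wrap (z t)"]
    unfolding sol_iff by (simp add: norm_hilbert_def hilbert_eq_iff)
  have decay: "\<exists>C. eventually (\<lambda>t. norm (z t) \<le> C * t powr (- (1 / (2 - r)))) at_top"
    if "mild_solution scal S B ?V z0 z" for z0 z
    using trajectory_decay that unfolding sol_iff by (fastforce simp: norm_hilbert_def)
  have "strongly_stabilizes scal S B ?V"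
    unfolding strongly_stabilizes_def
  proof (intro conjI allI impI)
    fix z0
    obtain z where z: "mild (\<lambda>t. F' (z t)) (wrap z0) z" using trajectory_exists by blast
    then have "mild_solution scal S B ?V z0 (\<lambda>t. unwrap (z t))"
      by (simp add: sol_iff unwrap_inverse)
    moreover have "w t = unwrap (z t)" if "mild_solution scal S B ?V z0 w" "t \<ge> 0" for w t
      using trajectory_unique[OF _ z, of "\<lambda>t. wrap (w t)" t] that by (simp add: sol_iff hilbert_eq_iff)
    ultimately show "\<exists>z. mild_solution scal S B ?V z0 z \<and>
        (\<forall>w. mild_solution scal S B ?V z0 w \<longrightarrow> (\<forall>t\<ge>0. w t = z t))"
      by blast
  next
    fix \<epsilon> :: real assume "\<epsilon> > 0"
    then show "\<exists>\<alpha>>0. \<forall>z0 z. mild_solution scal S B ?V z0 z \<longrightarrow> norm z0 < \<alpha> \<longrightarrow>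
        (\<forall>t\<ge>0. norm (z t) < \<epsilon>)"
      using decreasing by (intro exI[of _ \<epsilon>]) (auto intro: le_less_trans)
  next
    fix z0 z assume "mild_solution scal S B ?V z0 z"
    from decay[OF this]
    obtain C where C: "eventually (\<lambda>t. norm (z t) \<le> C * t powr (- (1 / (2 - r)))) at_top" ..
    have "((\<lambda>t. t powr (- (1 / (2 - r)))) \<longlongrightarrow> 0) at_top"
      using assms(8) by (intro tendsto_neg_powr filterlim_ident) auto
    then have "((\<lambda>t. C * t powr (- (1 / (2 - r)))) \<longlongrightarrow> 0) at_top" by (rule tendsto_mult_right_zero)
    with C show "(z \<longlongrightarrow> 0) at_top" by (rule Lim_null_comparison)
  qed
  moreover have "(\<lambda>t. norm (z t)) \<in> O[at_top](\<lambda>t. t powr (- (1 / (2 - r))))"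
    if sol: "mild_solution scal S B ?V z0 z" for z0 z
  proof -
    obtain C where "eventually (\<lambda>t. norm (z t) \<le> C * t powr (- (1 / (2 - r)))) at_top"
      using decay[OF sol] by blast
    then show ?thesis by (intro bigoI[of _ C]) simp
  qed
  ultimately show ?thesis by blast
qed

end
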